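(* If $G$ is a block graph with $\operatorname{diam}(G) \leq 4$, then the $r$-independence complex $\mathrm{Ind}_r(G)$ is shellable for all integers $r \geq 2$.
   Context: All graphs are finite and simple. A block of a graph is a maximal connected subgraph that remains connected after removal of any single vertex; $G$ is a block graph if every block is a complete graph. $\operatorname{diam}(G)$ is the maximum over pairs of vertices of the length of a shortest path between them. For $r \geq 1$, a subset $A \subseteq V(G)$ is $r$-independent if every connected component of $G[A]$ has at most $r$ vertices; $\mathrm{Ind}_r(G)$ is the simplicial complex on $V(G)$ of all $r$-independent subsets. A (not necessarily pure) simplicial complex is shellable if its facets can be ordered $F_1,\dots,F_t$ so that for each $k>1$, $\langle F_k\rangle \cap \langle F_1,\dots,F_{k-1}\rangle$ is pure of dimension $\dim F_k-1$ ($\langle\mathcal F\rangle$ = complex generated by $\mathcal F$). *)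

theory Defs
  imports "Graph_Theory.Graph_Theory"
begin

section \<open>Graphs\<close>

text \<open>
  As in Graph_Theory, a finite simple graph is a finite symmetric digraph without loops and
  parallel arcs (locale \<open>graph\<close>): each edge is a pair of opposite arcs. Accordingly a subgraph in
  the undirected sense is a symmetric \<open>subgraph\<close>. Graph_Theory's \<open>connected\<close> is false for the graph
  without vertices.
\<close>

definition component :: "('a,'b) pre_digraph \<Rightarrow> ('a,'b) pre_digraph \<Rightarrow> bool" where
  "component G C \<longleftrightarrow>
     pre_digraph.max_subgraph G (\<lambda>H. symmetric H \<and> Digraph_Component.connected H) C"

text \<open>
  The guard \<open>verts H \<noteq> {v}\<close> makes a single vertex count as remaining connected after its removal,
  so that an isolated vertex is a block, as is usual.
\<close>

definition block :: "('a,'b) pre_digraph \<Rightarrow> ('a,'b) pre_digraph \<Rightarrow> bool" where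
  "block G B \<longleftrightarrow>
     pre_digraph.max_subgraph G
       (\<lambda>H. symmetric H \<and> Digraph_Component.connected H \<and>
            (\<forall>v\<in>verts H. verts H \<noteq> {v} \<longrightarrow> Digraph_Component.connected (pre_digraph.del_vert H v))) B"

definition block_graph :: "('a,'b) pre_digraph \<Rightarrow> bool" where
  "block_graph G \<longleftrightarrow> graph G \<and> (\<forall>B. block G B \<longrightarrow> (\<exists>n. K\<^bsub>n\<^esub> B))"

text \<open>
  With unit weights, \<open>wf_digraph.\<mu>\<close> is the length of a shortest walk, and \<open>\<infinity>\<close> if there is none;
  so the diameter of a disconnected graph is \<open>\<infinity>\<close>.
\<close>

definition diam :: "('a,'b) pre_digraph \<Rightarrow> ereal" where
  "diam G = (SUP u\<in>verts G. SUP v\<in>verts G. wf_digraph.\<mu> G (\<lambda>_. 1) u v)"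


section \<open>Simplicial complexes\<close>

definition simplicial_complex :: "'a set \<Rightarrow> 'a set set \<Rightarrow> bool" where
  "simplicial_complex V K \<longleftrightarrow>
     finite V \<and> K \<subseteq> Pow V \<and> {} \<in> K \<and> (\<forall>F\<in>K. \<forall>F'. F' \<subseteq> F \<longrightarrow> F' \<in> K)"

definition facets :: "'a set set \<Rightarrow> 'a set set" where
  "facets K = {F \<in> K. \<forall>F'\<in>K. F \<subseteq> F' \<longrightarrow> F' = F}"

definition face_dim :: "'a set \<Rightarrow> int" where
  "face_dim F = int (card F) - 1"

definition generated_complex :: "'a set set \<Rightarrow> 'a set set" where
  "generated_complex \<F> = {\<sigma>. \<exists>F\<in>\<F>. \<sigma> \<subseteq> F}"

definition pure_of_dim :: "'a set set \<Rightarrow> int \<Rightarrow> bool" where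
  "pure_of_dim K d \<longleftrightarrow> facets K \<noteq> {} \<and> (\<forall>F\<in>facets K. face_dim F = d)"

text \<open>Non-pure shellability; the list is indexed from 0, so \<open>k > 1\<close> becomes \<open>k > 0\<close>.\<close>

definition shellable :: "'a set set \<Rightarrow> bool" where
  "shellable K \<longleftrightarrow>
     (\<exists>Fs. distinct Fs \<and> set Fs = facets K \<and>
        (\<forall>k. 0 < k \<and> k < length Fs \<longrightarrow>
           pure_of_dim (generated_complex {Fs ! k} \<inter> generated_complex (set (take k Fs)))
             (face_dim (Fs ! k) - 1)))"


section \<open>The \<open>r\<close>-independence complex\<close>

definition r_independent :: "nat \<Rightarrow> ('a,'b) pre_digraph \<Rightarrow> 'a set \<Rightarrow> bool" where
  "r_independent r G A \<longleftrightarrow>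
     A \<subseteq> verts G \<and> (\<forall>C. component (G \<restriction> A) C \<longrightarrow> card (verts C) \<le> r)"

definition Ind :: "nat \<Rightarrow> ('a,'b) pre_digraph \<Rightarrow> 'a set set" where
  "Ind r G = {A. r_independent r G A}"

lemma (in fin_digraph) ex_max_subgraph:
  assumes "subgraph C G" "P C"
  shows "\<exists>D. max_subgraph P D \<and> subgraph C D"
proof -
  let ?f = "\<lambda>H. card (verts H) + card (arcs H)"
  let ?Q = "\<lambda>H. subgraph C H \<and> subgraph H G \<and> P H"
  have QC: "?Q C"
    using assms by (auto simp: subgraph_def compatible_def)
  have bnd: "\<forall>H. ?Q H \<longrightarrow> ?f H < Suc (card (verts G) + card (arcs G))"
    by (auto simp: subgraph_def less_Suc_eq_le intro!: add_mono card_mono)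
  obtain D where D: "?Q D" and max: "\<forall>H. ?Q H \<longrightarrow> ?f H \<le> ?f D"
    using ex_has_greatest_nat[of ?Q C ?f, OF QC bnd] by (elim exE conjE) (rule that, simp_all)
  have "max_subgraph P D"
    unfolding max_subgraph_def
  proof (intro conjI allI impI notI)
    show "subgraph D G" "P D" using D by auto
    fix H assume H: "H \<noteq> D \<and> subgraph D H" "subgraph H G \<and> P H"
    then have "?Q H" using D subgraph_trans by blast
    then have le: "?f H \<le> ?f D" using max by blast
    interpret H: fin_digraph H using H fin_digraph_subgraph by blast
    have sub: "verts D \<subseteq> verts H" "arcs D \<subseteq> arcs H" using H by (auto simp: subgraph_def)
    then have "card (verts D) \<le> card (verts H)" "card (arcs D) \<le> card (arcs H)"
      by (auto intro: card_mono)
    then have "card (verts D) = card (verts H)" "card (arcs D) = card (arcs H)"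
      using le by auto
    then have "verts D = verts H" "arcs D = arcs H"
      using sub by (auto simp: card_subset_eq)
    moreover have "tail D = tail H" "head D = head H"
      using H by (auto simp: subgraph_def compatible_def)
    ultimately show False using H by (simp add: pre_digraph.equality)
  qed
  then show ?thesis using D by blast
qed

lemma (in graph) r_independent_subset:
  assumes B: "r_independent r G B" and AB: "A \<subseteq> B"
  shows "r_independent r G A"
  unfolding r_independent_def
proof (intro conjI allI impI)
  show "A \<subseteq> verts G" using assms by (auto simp: r_independent_def)
  fix C assume C: "component (G \<restriction> A) C"
  have BV: "B \<subseteq> verts G" using B by (simp add: r_independent_def)
  interpret GB: fin_digraph "G \<restriction> B"
    using BV subgraph_induce_subgraphI fin_digraph_subgraph by blast
  let ?P = "\<lambda>H. symmetric H \<and> Digraph_Component.connected H"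
  have "subgraph C (G \<restriction> A)" "?P C"
    using C by (auto simp: component_def pre_digraph.max_subgraph_def)
  moreover from this have "subgraph C (G \<restriction> B)"
    using AB GB.wf_digraph by (auto simp: subgraph_def compatible_def)
  ultimately obtain D where D: "GB.max_subgraph ?P D" "subgraph C D"
    using GB.ex_max_subgraph[of C ?P] by blast
  have "card (verts D) \<le> r"
    using D B by (simp add: r_independent_def component_def)
  moreover have "verts D \<subseteq> B"
    using D by (auto simp: GB.max_subgraph_def subgraph_def)
  then have "finite (verts D)"
    using BV finite_verts by (meson finite_subset)
  then have "card (verts C) \<le> card (verts D)"
    using D by (auto simp: subgraph_def intro: card_mono)
  ultimately show "card (verts C) \<le> r" by simp
qed

lemma (in graph) simplicial_complex_Ind: "simplicial_complex (verts G) (Ind r G)"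
proof -
  have "r_independent r G {}"
    by (auto simp: r_independent_def component_def pre_digraph.max_subgraph_def subgraph_def)
  moreover have "A \<subseteq> verts G" if "r_independent r G A" for A
    using that by (simp add: r_independent_def)
  moreover have "r_independent r G A" if "r_independent r G B" "A \<subseteq> B" for A B
    using that by (rule r_independent_subset)
  ultimately show ?thesis
    unfolding simplicial_complex_def Ind_def using finite_verts by simp blast
qed

end

theory Submission
  imports Defs
begin

text \<open>
  Order the facets of a complex by a vertex \<open>x\<close> that is simplicial for the clutter of minimal
  non-faces: first those containing \<open>x\<close>, then, for each minimal non-face \<open>e\<close> through \<open>x\<close>, those
  containing \<open>e - {x}\<close>. This reduces shellability to links, so it suffices that the link of every
  face other than a facet has such a vertex.

  A block graph of diameter at most 4 has a vertex \<open>v\<close> within distance 2 of all others, and the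
  vertices at distance 2 are simplicial in the graph, hence simplicial in every link of \<open>Ind r G\<close>
  to which they belong. In a link without such vertices, each remaining neighbour \<open>u\<close> of \<open>v\<close>
  carries a fixed set of vertices of the face, and a neighbour carrying fewest is simplicial:
  replacing it by another one in a connected set does not decrease the number of vertices.
\<close>

section \<open>Shellings by simplicial vertices\<close>

text \<open>The exchange form of shelling: each intersection of \<open>F\<close> with an earlier
  \<open>H\<close> lies in a face \<open>F - {y}\<close> that also lies in an earlier
  \<open>J\<close>. The parameter \<open>P\<close> collects the sets placed before the list, so that
  segments can be treated separately.\<close>

primrec shelling_from :: "'a set set \<Rightarrow> 'a set list \<Rightarrow> bool" where
  "shelling_from P [] \<longleftrightarrow> True"
| "shelling_from P (F # Fs) \<longleftrightarrow>
     (\<forall>H\<in>P. \<exists>y\<in>F - H. \<exists>J\<in>P. F - {y} \<subseteq> J) \<and> shelling_from (insert F P) Fs"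

lemma shelling_from_append:
  "shelling_from P (xs @ ys) \<longleftrightarrow> shelling_from P xs \<and> shelling_from (P \<union> set xs) ys"
  by (induction xs arbitrary: P) auto

lemma shelling_from_Un:
  assumes "shelling_from P Fs"
    and "\<And>F H. F \<in> set Fs \<Longrightarrow> H \<in> Q \<Longrightarrow> \<exists>y\<in>F - H. \<exists>J\<in>Q. F - {y} \<subseteq> J"
  shows "shelling_from (P \<union> Q) Fs"
  using assms
proof (induction Fs arbitrary: P)
  case (Cons F Fs)
  have "\<exists>y\<in>F - H. \<exists>J\<in>P \<union> Q. F - {y} \<subseteq> J" if "H \<in> P \<union> Q" for H
    using that
  proof
    assume "H \<in> P"
    then obtain y J where "y \<in> F - H" "J \<in> P" "F - {y} \<subseteq> J"
      using Cons.prems(1) by (simp only: shelling_from.simps) blast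
    then show ?thesis by blast
  next
    assume "H \<in> Q"
    then obtain y J where "y \<in> F - H" "J \<in> Q" "F - {y} \<subseteq> J"
      using Cons.prems(2)[of F H] by (meson list.set_intros(1))
    then show ?thesis by blast
  qed
  moreover have "shelling_from (insert F P \<union> Q) Fs"
    using Cons.prems by (intro Cons.IH) auto
  ultimately show ?case by simp
qed simp

text \<open>Every set of a segment \<open>L e\<close> exchanges with anything outside the segment by
  way of the fixed initial family \<open>P0\<close>. Hence the segments may follow one another in
  any order; in the induction \<open>P\<close> grows while \<open>P0\<close> stays.\<close>

lemma shelling_from_concat:
  assumes "\<And>e. e \<in> set es \<Longrightarrow> shelling_from {} (L e)"
    and "P0 \<subseteq> P"
    and "\<And>e F H. e \<in> set es \<Longrightarrow> F \<in> set (L e) \<Longrightarrow>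
          H \<in> P \<or> (\<exists>e'\<in>set es. e' \<noteq> e \<and> H \<in> set (L e')) \<Longrightarrow>
          \<exists>y\<in>F - H. \<exists>J\<in>P0. F - {y} \<subseteq> J"
    and "distinct es"
  shows "shelling_from P (concat (map L es))"
  using assms
proof (induction es arbitrary: P)
  case (Cons e es)
  have "shelling_from ({} \<union> P) (L e)"
  proof (rule shelling_from_Un)
    fix F H assume "F \<in> set (L e)" "H \<in> P"
    then have "\<exists>y\<in>F - H. \<exists>J\<in>P0. F - {y} \<subseteq> J"
      using Cons.prems(3)[of e F H] by simp
    then show "\<exists>y\<in>F - H. \<exists>J\<in>P. F - {y} \<subseteq> J"
      using Cons.prems(2) by blast
  qed (use Cons.prems in simp)
  moreover have "shelling_from (P \<union> set (L e)) (concat (map L es))"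
  proof (rule Cons.IH)
    show "\<exists>y\<in>F - H. \<exists>J\<in>P0. F - {y} \<subseteq> J"
      if "e' \<in> set es" "F \<in> set (L e')"
        "H \<in> P \<union> set (L e) \<or> (\<exists>e''\<in>set es. e'' \<noteq> e' \<and> H \<in> set (L e''))" for e' F H
      by (rule Cons.prems(3)[of e' F H]) (use that Cons.prems(4) in auto)
  qed (use Cons.prems in auto)
  ultimately show ?case by (simp add: shelling_from_append)
qed simp

text \<open>By the exchanges, each face of the intersection with the earlier facets lies in some
  \<open>F - {y}\<close> that belongs to the intersection, where \<open>F\<close> is the new facet.
  So these sets are its facets, and they have the right dimension.\<close>

lemma shellableI:
  assumes dist: "distinct Fs" and set: "set Fs = facets K"
    and fin: "\<And>F. F \<in> facets K \<Longrightarrow> finite F"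
    and sh: "shelling_from {} Fs"
  shows "shellable K"
  unfolding shellable_def
proof (intro exI conjI allI impI)
  fix k assume k: "0 < k \<and> k < length Fs"
  let ?F = "Fs ! k" and ?P = "set (take k Fs)"
  let ?L = "generated_complex {?F} \<inter> generated_complex ?P"
  have "Fs = take k Fs @ ?F # drop (Suc k) Fs"
    using k by (simp add: id_take_nth_drop)
  then have "shelling_from {} (take k Fs @ ?F # drop (Suc k) Fs)"
    using sh by simp
  then have step: "\<exists>y\<in>?F - H. \<exists>J\<in>?P. ?F - {y} \<subseteq> J" if "H \<in> ?P" for H
    using that by (simp add: shelling_from_append)
  have finF: "finite ?F" using fin set k by (metis nth_mem)
  have "Fs ! 0 \<in> ?P" using k by (auto simp: in_set_conv_nth intro!: exI[of _ 0])
  \<comment> \<open>The empty face, covered by some \<open>F - {y}\<close>, shows that there is a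
    facet at all.\<close>
  then have empty: "{} \<in> ?L" by (auto simp: generated_complex_def)
  have cover: "\<exists>y\<in>?F. \<sigma> \<subseteq> ?F - {y} \<and> ?F - {y} \<in> ?L" if \<sigma>: "\<sigma> \<in> ?L" for \<sigma>
  proof -
    obtain H where H: "H \<in> ?P" "\<sigma> \<subseteq> H" "\<sigma> \<subseteq> ?F"
      using \<sigma> unfolding generated_complex_def by blast
    obtain y J where "y \<in> ?F - H" "J \<in> ?P" "?F - {y} \<subseteq> J"
      using step[OF H(1)] by blast
    with H show ?thesis by (auto simp: generated_complex_def)
  qed
  have facetI: "?F - {y} \<in> facets ?L" if y: "y \<in> ?F" "?F - {y} \<in> ?L" for y
  proof -
    have "\<sigma> = ?F - {y}" if "\<sigma> \<in> ?L" "?F - {y} \<subseteq> \<sigma>" for \<sigma>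
      using cover[OF that(1)] that(2) y(1) by blast
    with y show ?thesis by (auto simp: facets_def)
  qed
  have "facets ?L \<noteq> {}" using cover[OF empty] facetI by blast
  moreover have "face_dim \<sigma> = face_dim ?F - 1" if "\<sigma> \<in> facets ?L" for \<sigma>
  proof -
    have "\<sigma> \<in> ?L" using that by (simp add: facets_def)
    then obtain y where y: "y \<in> ?F" "\<sigma> \<subseteq> ?F - {y}" "?F - {y} \<in> ?L"
      using cover by blast
    then have "\<sigma> = ?F - {y}" using that by (auto simp: facets_def)
    moreover have "card ?F > 0" using y(1) finF by (auto simp: card_gt_0_iff)
    ultimately show ?thesis
      using y(1) finF by (simp add: face_dim_def card_Diff_singleton of_nat_diff)
  qed
  ultimately show "pure_of_dim ?L (face_dim ?F - 1)"
    by (simp add: pure_of_dim_def)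
qed (use dist set in simp_all)

section \<open>Minimal non-faces of links and the shelling they induce\<close>

definition link_circuit :: "'a set set \<Rightarrow> 'a set \<Rightarrow> 'a set \<Rightarrow> bool" where
  "link_circuit K S e \<longleftrightarrow> e \<inter> S = {} \<and> S \<union> e \<notin> K \<and> (\<forall>z\<in>e. S \<union> (e - {z}) \<in> K)"

text \<open>
  A vertex of a link that is simplicial in the sense of Woodroofe, for the clutter of minimal
  non-faces of the link. Since \<open>K\<close> is closed under subsets, it need not be said that some circuit
  lies in \<open>e1 \<union> e2 - {x}\<close>.
\<close>

definition link_simplicial :: "'a set set \<Rightarrow> 'a set \<Rightarrow> 'a \<Rightarrow> bool" where
  "link_simplicial K S x \<longleftrightarrow> x \<notin> S \<and> insert x S \<in> K \<and>
     (\<forall>e1 e2. link_circuit K S e1 \<longrightarrow> link_circuit K S e2 \<longrightarrow> x \<in> e1 \<longrightarrow> x \<in> e2 \<longrightarrow> e1 \<noteq> e2 \<longrightarrow>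
        S \<union> (e1 \<union> e2 - {x}) \<notin> K)"

lemma link_circuit_subset:
  assumes "finite A" "S \<union> A \<notin> K"
  obtains e where "e \<subseteq> A" "link_circuit K S e"
proof -
  let ?Q = "\<lambda>e. e \<subseteq> A - S \<and> S \<union> e \<notin> K"
  have "S \<union> (A - S) = S \<union> A" by blast
  then have "?Q (A - S)" using assms by simp
  then obtain e where e: "?Q e" "\<And>e'. ?Q e' \<Longrightarrow> card e \<le> card e'"
    using ex_has_least_nat[of ?Q "A - S" card] by blast
  have "finite e" using e(1) assms(1) by (meson finite_Diff finite_subset)
  have "S \<union> (e - {z}) \<in> K" if "z \<in> e" for z
  proof (rule ccontr)
    assume "S \<union> (e - {z}) \<notin> K"
    then have "card e \<le> card (e - {z})" using e(1) by (intro e(2)) auto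
    then show False using that \<open>finite e\<close> by (meson card_Diff1_less not_le)
  qed
  then show ?thesis using e(1) by (intro that[of e]) (auto simp: link_circuit_def)
qed

lemma facet_superset:
  assumes K: "simplicial_complex V K" and S: "S \<in> K"
  obtains F where "F \<in> facets K" "S \<subseteq> F"
proof -
  have fin: "finite V" and sub: "\<And>F. F \<in> K \<Longrightarrow> F \<subseteq> V"
    using K by (auto simp: simplicial_complex_def)
  have "finite K" using fin sub by (meson PowI finite_Pow_iff finite_subset subsetI)
  then obtain F where "F \<in> K" "S \<subseteq> F" "\<forall>F'\<in>K. F \<subseteq> F' \<longrightarrow> F = F'"
    using finite_has_maximal2[OF _ S] by blast
  then show ?thesis by (intro that[of F]) (auto simp: facets_def)
qed

text \<open>Induction on the number of vertices outside \<open>S\<close>. With \<open>x\<close>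
  simplicial in the link, the facets over \<open>S\<close> split into those over
  \<open>insert x S\<close> and, for each circuit \<open>e\<close> through \<open>x\<close>, those
  over \<open>S \<union> (e - {x})\<close>. Each class is shelled by induction, and exchanges
  between classes pass through the first one.\<close>

lemma facets_over_shelling:
  assumes K: "simplicial_complex V K"
    and simp: "\<And>S. S \<in> K \<Longrightarrow> S \<notin> facets K \<Longrightarrow> \<exists>x. link_simplicial K S x"
    and "S \<in> K"
  shows "\<exists>Fs. distinct Fs \<and> set Fs = {F \<in> facets K. S \<subseteq> F} \<and> shelling_from {} Fs"
  using \<open>S \<in> K\<close>
proof (induction "card (V - S)" arbitrary: S rule: less_induct)
  case less
  have finV: "finite V" and sub: "\<And>F. F \<in> K \<Longrightarrow> F \<subseteq> V"
    and down: "\<And>F F'. F \<in> K \<Longrightarrow> F' \<subseteq> F \<Longrightarrow> F' \<in> K"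
    using K by (auto simp: simplicial_complex_def)
  have finF: "finite F" if "F \<in> K" for F using sub[OF that] finV by (rule finite_subset)
  have facetK: "F \<in> K" if "F \<in> facets K" for F using that by (simp add: facets_def)
  show ?case
  proof (cases "S \<in> facets K")
    case True
    then have "{F \<in> facets K. S \<subseteq> F} = {S}" by (auto simp: facets_def)
    then show ?thesis by (intro exI[of _ "[S]"]) simp
  next
    case False
    then obtain x where x: "x \<notin> S" "insert x S \<in> K"
      and circ: "\<And>e1 e2. link_circuit K S e1 \<Longrightarrow> link_circuit K S e2 \<Longrightarrow> x \<in> e1 \<Longrightarrow> x \<in> e2
                  \<Longrightarrow> e1 \<noteq> e2 \<Longrightarrow> S \<union> (e1 \<union> e2 - {x}) \<notin> K"
      using simp[OF less.prems] by (auto simp: link_simplicial_def)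
    have smaller: "card (V - S') < card (V - S)" if "S' \<in> K" "S \<subset> S'" for S'
      using that sub[OF that(1)] finV by (intro psubset_card_mono) auto
    define C where "C = {e. link_circuit K S e \<and> x \<in> e \<and> e \<subseteq> V}"
    have "finite C" unfolding C_def using finV by (auto intro: finite_subset[of _ "Pow V"])
    then obtain es where es: "set es = C" "distinct es" using finite_distinct_list by blast
    obtain L0 where L0: "distinct L0" "set L0 = {F \<in> facets K. insert x S \<subseteq> F}"
      "shelling_from {} L0"
      using less.hyps[OF smaller x(2)] x by blast
    have "\<exists>Fs. distinct Fs \<and> set Fs = {F \<in> facets K. S \<union> (e - {x}) \<subseteq> F} \<and> shelling_from {} Fs"
      if "e \<in> C" for e
    proof -
      have e: "S \<union> (e - {x}) \<in> K" "e \<inter> S = {}" "S \<union> e \<notin> K" "x \<in> e"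
        using that by (auto simp: C_def link_circuit_def)
      \<comment> \<open>\<open>insert x S\<close> is a face, so \<open>e\<close> has a further
        vertex and \<open>S\<close> properly grows.\<close>
      then have "e \<noteq> {x}" using x by auto
      then have "S \<subset> S \<union> (e - {x})" using e by auto
      then show ?thesis by (intro less.hyps smaller e)
    qed
    then obtain L where L: "\<And>e. e \<in> C \<Longrightarrow> distinct (L e)"
      "\<And>e. e \<in> C \<Longrightarrow> set (L e) = {F \<in> facets K. S \<union> (e - {x}) \<subseteq> F}"
      "\<And>e. e \<in> C \<Longrightarrow> shelling_from {} (L e)"
      by metis
    have noface: "\<not> S \<union> e \<subseteq> F" if "e \<in> C" "F \<in> K" for e F
      using that down by (auto simp: C_def link_circuit_def)
    have noboth: "\<not> S \<union> (e - {x}) \<union> (e' - {x}) \<subseteq> F"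
      if "e \<in> C" "e' \<in> C" "e \<noteq> e'" "F \<in> K" for e e' F
    proof
      assume "S \<union> (e - {x}) \<union> (e' - {x}) \<subseteq> F"
      then have "S \<union> (e \<union> e' - {x}) \<in> K" by (intro down[OF that(4)]) blast
      then show False using circ that by (auto simp: C_def)
    qed
    \<comment> \<open>A face over \<open>S\<close> that \<open>x\<close> does not extend contains
      \<open>e - {x}\<close> for some circuit \<open>e\<close> through \<open>x\<close>; this makes
      the classes exhaustive.\<close>
    have circuit_ex: "\<exists>e\<in>C. e \<subseteq> insert x F" if F: "F \<in> K" "S \<subseteq> F" "insert x F \<notin> K" for F
    proof -
      have "S \<union> insert x F = insert x F" using F by auto
      then obtain e where e: "e \<subseteq> insert x F" "link_circuit K S e"
        using link_circuit_subset[of "insert x F" S K] F finF by auto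
      have "x \<in> e"
      proof (rule ccontr)
        assume "x \<notin> e"
        then have "S \<union> e \<subseteq> F" using e F by auto
        then show False using down[OF F(1)] e(2) by (auto simp: link_circuit_def)
      qed
      moreover have "e \<subseteq> V" using e(1) sub[OF F(1)] sub[OF x(2)] by auto
      ultimately show ?thesis using e by (auto simp: C_def)
    qed
    let ?Fs = "L0 @ concat (map L es)"
    have "set ?Fs = {F \<in> facets K. S \<subseteq> F}"
    proof (intro equalityI subsetI)
      fix F assume "F \<in> set ?Fs"
      then show "F \<in> {F \<in> facets K. S \<subseteq> F}" using L0(2) L(2) es(1) by auto
    next
      fix F assume F: "F \<in> {F \<in> facets K. S \<subseteq> F}"
      show "F \<in> set ?Fs"
      proof (cases "x \<in> F")
        case True
        then show ?thesis using F L0(2) by auto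
      next
        case False
        then have "insert x F \<notin> K" using F by (auto simp: facets_def)
        then obtain e where "e \<in> C" "e \<subseteq> insert x F" using circuit_ex F facetK by blast
        then have "F \<in> set (L e)" using L(2) F by auto
        then show ?thesis using \<open>e \<in> C\<close> es(1) by auto
      qed
    qed
    moreover have "distinct ?Fs"
    proof -
      have disj: "set (L e) \<inter> set (L e') = {}" if "e \<in> C" "e' \<in> C" "e \<noteq> e'" for e e'
      proof (intro equals0I)
        fix F assume "F \<in> set (L e) \<inter> set (L e')"
        then have "F \<in> K" "S \<union> (e - {x}) \<subseteq> F" "S \<union> (e' - {x}) \<subseteq> F"
          using L(2)[OF that(1)] L(2)[OF that(2)] facetK by blast+
        then show False using noboth[OF that, of F] by blast
      qed
      \<comment> \<open>Distinctness of the concatenation requires the lists themselves to be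
        distinct, which for disjoint lists follows once none is empty.\<close>
      have ne: "L e \<noteq> []" if "e \<in> C" for e
      proof -
        have "S \<union> (e - {x}) \<in> K" using that by (auto simp: C_def link_circuit_def)
        then obtain F where "F \<in> facets K" "S \<union> (e - {x}) \<subseteq> F"
          using facet_superset[OF K] by blast
        then have "F \<in> set (L e)" using L(2)[OF that] by blast
        then show ?thesis by auto
      qed
      have "inj_on L C"
      proof (rule inj_onI, rule ccontr)
        fix e e' assume e: "e \<in> C" "e' \<in> C" "L e = L e'" "e \<noteq> e'"
        then have "set (L e) = {}" using disj[of e e'] by simp
        then show False using ne[OF e(1)] by simp
      qed
      then have "distinct (map L es)" using es by (simp add: distinct_map)
      then have "distinct (concat (map L es))"
      proof (rule distinct_concat)
        show "distinct ys" if "ys \<in> set (map L es)" for ys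
          using that L(1) es(1) by auto
        show "set ys \<inter> set zs = {}"
          if yz: "ys \<in> set (map L es)" "zs \<in> set (map L es)" "ys \<noteq> zs" for ys zs
        proof -
          obtain e e' where "e \<in> C" "ys = L e" "e' \<in> C" "zs = L e'"
            using yz es(1) by auto
          then show ?thesis using disj[of e e'] yz(3) by blast
        qed
      qed
      moreover have "set L0 \<inter> set (L e) = {}" if "e \<in> C" for e
      proof (intro equals0I)
        fix F assume "F \<in> set L0 \<inter> set (L e)"
        then have "F \<in> K" "insert x S \<subseteq> F" "S \<union> (e - {x}) \<subseteq> F"
          using L(2)[OF that] L0(2) facetK by blast+
        then show False using noface[OF that, of F] by blast
      qed
      ultimately show ?thesis using L0(1) es(1) by auto
    qed
    moreover have "shelling_from {} ?Fs"
    proof -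
      have "shelling_from (set L0) (concat (map L es))"
      proof (rule shelling_from_concat[where P0 = "set L0"])
        fix e F H
        assume e: "e \<in> set es" and F: "F \<in> set (L e)"
          and H: "H \<in> set L0 \<or> (\<exists>e'\<in>set es. e' \<noteq> e \<and> H \<in> set (L e'))"
        have eC: "e \<in> C" using e es by simp
        have F': "F \<in> K" "S \<union> (e - {x}) \<subseteq> F" using F L(2)[OF eC] facetK by auto
        have "x \<in> e" using eC by (simp add: C_def)
        from H have "\<not> S \<union> (e - {x}) \<subseteq> H"
        proof
          assume "H \<in> set L0"
          then show ?thesis using noface[OF eC, of H] L0(2) facetK \<open>x \<in> e\<close> by auto
        next
          assume "\<exists>e'\<in>set es. e' \<noteq> e \<and> H \<in> set (L e')"
          then obtain e' where e': "e' \<in> C" "e' \<noteq> e" "H \<in> set (L e')" using es by auto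
          then have "H \<in> K" "S \<union> (e' - {x}) \<subseteq> H" using L(2) facetK by auto
          then show ?thesis using noboth[OF eC e'(1), of H] e'(2) by auto
        qed
        moreover have "S \<subseteq> H" using H L0(2) L(2) es by auto
        ultimately obtain y where y: "y \<in> e" "y \<noteq> x" "y \<notin> H" by auto
        have "y \<notin> S" using eC y(1) by (auto simp: C_def link_circuit_def)
        \<comment> \<open>Trading \<open>y\<close> for \<open>x\<close> gives a face: otherwise
          \<open>F\<close> would contain \<open>e - {x}\<close> and \<open>e' - {x}\<close> for a
          second circuit \<open>e'\<close>, different from \<open>e\<close> because it misses
          \<open>y\<close>.\<close>
        have "insert x (F - {y}) \<in> K"
        proof (rule ccontr)
          assume "insert x (F - {y}) \<notin> K"
          moreover have "F - {y} \<in> K" "S \<subseteq> F - {y}" using F' \<open>y \<notin> S\<close> down by auto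
          ultimately obtain e' where e': "e' \<in> C" "e' \<subseteq> insert x (F - {y})"
            using circuit_ex by blast
          then have "e \<noteq> e'" using y by auto
          then show False using noboth[OF eC e'(1) _ F'(1)] e'(2) F'(2) by auto
        qed
        then obtain J where J: "J \<in> facets K" "insert x (F - {y}) \<subseteq> J"
          using facet_superset[OF K] by blast
        have "J \<in> set L0" using J F' \<open>y \<notin> S\<close> L0(2) by auto
        then show "\<exists>y\<in>F - H. \<exists>J\<in>set L0. F - {y} \<subseteq> J" using y F' J by auto
      qed (use L(3) es in auto)
      then show ?thesis using L0(3) by (simp add: shelling_from_append)
    qed
    ultimately show ?thesis by blast
  qed
qed

lemma shellable_if_link_simplicial:
  assumes K: "simplicial_complex V K"
    and "\<And>S. S \<in> K \<Longrightarrow> S \<notin> facets K \<Longrightarrow> \<exists>x. link_simplicial K S x"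
  shows "shellable K"
proof -
  have "{} \<in> K" using K by (simp add: simplicial_complex_def)
  then obtain Fs where Fs: "distinct Fs" "set Fs = facets K" "shelling_from {} Fs"
    using facets_over_shelling[OF K assms(2), of "{}"] by simp blast
  have "finite F" if "F \<in> facets K" for F
  proof (rule finite_subset)
    show "F \<subseteq> V" "finite V" using that K by (auto simp: facets_def simplicial_complex_def)
  qed
  then show ?thesis using Fs by (intro shellableI)
qed

section \<open>Connected vertex sets\<close>

definition conn :: "'a rel \<Rightarrow> 'a set \<Rightarrow> bool" where
  "conn E T \<longleftrightarrow> T \<noteq> {} \<and> (\<forall>a\<in>T. \<forall>b\<in>T. (a, b) \<in> (Restr E T)\<^sup>*)"

text \<open>Bounding all connected subsets, not only the components, makes closure under subsets
  immediate.\<close>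

definition indep_sets :: "'a set \<Rightarrow> 'a rel \<Rightarrow> nat \<Rightarrow> 'a set set" where
  "indep_sets V E r = {A. A \<subseteq> V \<and> (\<forall>T\<subseteq>A. conn E T \<longrightarrow> card T \<le> r)}"

lemma indep_setsD: "A \<in> indep_sets V E r \<Longrightarrow> T \<subseteq> A \<Longrightarrow> conn E T \<Longrightarrow> card T \<le> r"
  by (simp add: indep_sets_def)

lemma not_indep_setsE:
  assumes "A \<notin> indep_sets V E r" "A \<subseteq> V"
  obtains T where "T \<subseteq> A" "conn E T" "r < card T"
  using assms by (auto simp: indep_sets_def not_le)

lemma rtrancl_Restr_mono: "T \<subseteq> T' \<Longrightarrow> (a, b) \<in> (Restr E T)\<^sup>* \<Longrightarrow> (a, b) \<in> (Restr E T')\<^sup>*"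
  using rtrancl_mono[of "Restr E T" "Restr E T'"] by blast

lemma sym_rtrancl_Restr: "sym E \<Longrightarrow> (a, b) \<in> (Restr E T)\<^sup>* \<Longrightarrow> (b, a) \<in> (Restr E T)\<^sup>*"
  by (rule symD[OF sym_rtrancl]) (auto simp: sym_def)

lemma connI:
  assumes "sym E" "c \<in> T" "\<And>a. a \<in> T \<Longrightarrow> (c, a) \<in> (Restr E T)\<^sup>*"
  shows "conn E T"
  unfolding conn_def
proof (intro conjI ballI)
  show "(a, b) \<in> (Restr E T)\<^sup>*" if "a \<in> T" "b \<in> T" for a b
    using sym_rtrancl_Restr[OF assms(1) assms(3)[OF that(1)]] assms(3)[OF that(2)]
    by (rule rtrancl_trans)
qed (use assms(2) in blast)

lemma conn_Un:
  assumes "sym E" "conn E A" "conn E B" "a \<in> A" "b \<in> B" "a = b \<or> (a, b) \<in> E"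
  shows "conn E (A \<union> B)"
proof (rule connI)
  have ab: "(a, b) \<in> (Restr E (A \<union> B))\<^sup>*" using assms by auto
  fix z assume "z \<in> A \<union> B"
  then show "(a, z) \<in> (Restr E (A \<union> B))\<^sup>*"
  proof
    assume "z \<in> A"
    then have "(a, z) \<in> (Restr E A)\<^sup>*" using assms by (simp add: conn_def)
    then show ?thesis by (rule rtrancl_Restr_mono[rotated]) blast
  next
    assume "z \<in> B"
    then have "(b, z) \<in> (Restr E B)\<^sup>*" using assms by (simp add: conn_def)
    then have "(b, z) \<in> (Restr E (A \<union> B))\<^sup>*" by (rule rtrancl_Restr_mono[rotated]) blast
    with ab show ?thesis by (rule rtrancl_trans)
  qed
qed (use assms in auto)

text \<open>A walk through \<open>x\<close> enters and leaves by neighbours of \<open>x\<close>,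
  which are equal or adjacent, so \<open>x\<close> can be bypassed.\<close>

lemma conn_remove_simplicial:
  assumes sym: "sym E" and T: "conn E T" "x \<in> T" "T \<noteq> {x}"
    and clique: "\<And>a b. (x, a) \<in> E \<Longrightarrow> (x, b) \<in> E \<Longrightarrow> a \<noteq> b \<Longrightarrow> (a, b) \<in> E"
  shows "conn E (T - {x})" "\<exists>a\<in>T - {x}. (x, a) \<in> E"
proof -
  let ?R = "(Restr E (T - {x}))\<^sup>*"
  obtain a where a: "a \<in> T - {x}" using T by blast
  \<comment> \<open>While the walk stands at \<open>x\<close>, the invariant remembers a neighbour
    \<open>c\<close> of \<open>x\<close> reached without \<open>x\<close>; the bypass resumes from
    \<open>c\<close>.\<close>
  have reach: "if b = x then \<exists>c\<in>T - {x}. (x, c) \<in> E \<and> (a, c) \<in> ?R else (a, b) \<in> ?R"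
    if "(a, b) \<in> (Restr E T)\<^sup>*" for b
    using that
  proof (induction rule: rtrancl_induct)
    case base
    then show ?case using a by simp
  next
    case (step b b')
    have E: "(b, b') \<in> E" "(b', b) \<in> E" using step.hyps(2) sym by (auto dest: symD)
    have mem: "b \<in> T" "b' \<in> T" using step.hyps(2) by auto
    consider "b = x" "b' = x" | "b = x" "b' \<noteq> x" | "b \<noteq> x" "b' = x" | "b \<noteq> x" "b' \<noteq> x" by blast
    then show ?case
    proof cases
      case 1
      then show ?thesis using step.IH by simp
    next
      case 2
      then obtain c where c: "c \<in> T - {x}" "(x, c) \<in> E" "(a, c) \<in> ?R" using step.IH by auto
      have "c = b' \<or> (c, b') \<in> E" using clique[of c b'] c E 2 by auto
      then have "(a, b') \<in> ?R"
      proof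
        assume "(c, b') \<in> E"
        then have "(c, b') \<in> Restr E (T - {x})" using c 2 mem by auto
        with c(3) show ?thesis by (rule rtrancl_into_rtrancl)
      qed (use c in simp)
      then show ?thesis using 2 by simp
    next
      case 3
      then have "(a, b) \<in> ?R" using step.IH by simp
      then show ?thesis using 3 E mem by auto
    next
      case 4
      then have "(b, b') \<in> Restr E (T - {x})" using E mem by auto
      moreover have "(a, b) \<in> ?R" using step.IH 4 by simp
      ultimately show ?thesis using 4 by (simp add: rtrancl_into_rtrancl)
    qed
  qed
  show "conn E (T - {x})"
  proof (rule connI[OF sym a])
    fix b assume b: "b \<in> T - {x}"
    then have "(a, b) \<in> (Restr E T)\<^sup>*" using a T(1) by (simp add: conn_def)
    from reach[OF this] b show "(a, b) \<in> ?R" by simp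
  qed
  have "(a, x) \<in> (Restr E T)\<^sup>*" using a T by (simp add: conn_def)
  from reach[OF this] show "\<exists>a\<in>T - {x}. (x, a) \<in> E" by auto
qed

text \<open>
  A circuit through \<open>x\<close> consists of the vertices outside \<open>S\<close> of a connected set with exactly
  \<open>r + 1\<close> vertices. Without \<open>x\<close>, the union of two such sets is still connected, since the
  neighbours of \<open>x\<close> are adjacent, and still has more than \<open>r\<close> vertices.
\<close>

lemma link_simplicial_if_clique:
  assumes fin: "finite V" and sym: "sym E" and r: "r \<ge> 1"
    and x: "x \<notin> S" "insert x S \<in> indep_sets V E r"
    and clique: "\<And>a b. (x, a) \<in> E \<Longrightarrow> (x, b) \<in> E \<Longrightarrow> a \<noteq> b \<Longrightarrow> (a, b) \<in> E"
  shows "link_simplicial (indep_sets V E r) S x"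
  unfolding link_simplicial_def
proof (intro conjI allI impI notI)
  let ?K = "indep_sets V E r"
  have big: "\<exists>T. T \<subseteq> S \<union> e \<and> T - S = e \<and> x \<in> T \<and> conn E (T - {x}) \<and> card (T - {x}) = r \<and>
      (\<exists>a\<in>T - {x}. (x, a) \<in> E)" if e: "link_circuit ?K S e" "x \<in> e" "S \<union> e \<subseteq> V" for e
  proof -
    obtain T where T: "T \<subseteq> S \<union> e" "conn E T" "card T > r"
      using not_indep_setsE[OF _ e(3)] e(1) by (auto simp: link_circuit_def)
    \<comment> \<open>Removing any vertex of \<open>e\<close> leaves a face, which cannot contain
      the large set \<open>T\<close>.\<close>
    have sub: "e \<subseteq> T"
    proof
      fix z assume z: "z \<in> e"
      then have "S \<union> (e - {z}) \<in> ?K" using e by (auto simp: link_circuit_def)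
      then have "\<not> T \<subseteq> S \<union> (e - {z})" using indep_setsD[OF _ _ T(2)] T(3) by (meson not_le)
      then show "z \<in> T" using T(1) by blast
    qed
    have xT: "x \<in> T" using sub e by blast
    have "T - {x} \<subseteq> S \<union> (e - {x})" using T by auto
    have "S \<union> (e - {x}) \<in> ?K" using e by (auto simp: link_circuit_def)
    have "T \<noteq> {x}" using T(3) r by auto
    then have rem: "conn E (T - {x})" "\<exists>a\<in>T - {x}. (x, a) \<in> E"
      using conn_remove_simplicial[OF sym T(2) xT] clique by simp_all
    have "card (T - {x}) \<le> r"
      by (rule indep_setsD[OF \<open>S \<union> (e - {x}) \<in> ?K\<close> \<open>T - {x} \<subseteq> S \<union> (e - {x})\<close> rem(1)])
    moreover have "finite T" using T(1) e(3) fin by (meson finite_subset)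
    ultimately have "card (T - {x}) = r" using T(3) xT by (simp add: card_Diff_singleton)
    moreover have "T - S = e" using sub T(1) e(1) by (auto simp: link_circuit_def)
    ultimately show ?thesis using T(1) xT rem by (intro exI[of _ T]) simp
  qed
  fix e1 e2
  assume e: "link_circuit ?K S e1" "link_circuit ?K S e2" "x \<in> e1" "x \<in> e2" "e1 \<noteq> e2"
    and K: "S \<union> (e1 \<union> e2 - {x}) \<in> ?K"
  have V: "S \<union> e1 \<subseteq> V" "S \<union> e2 \<subseteq> V" using K x by (auto simp: indep_sets_def)
  obtain T1 where T1: "T1 \<subseteq> S \<union> e1" "T1 - S = e1" "x \<in> T1" "conn E (T1 - {x})"
      "card (T1 - {x}) = r" "\<exists>a\<in>T1 - {x}. (x, a) \<in> E"
    using big[OF e(1) e(3) V(1)] by blast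
  obtain T2 where T2: "T2 \<subseteq> S \<union> e2" "T2 - S = e2" "x \<in> T2" "conn E (T2 - {x})"
      "card (T2 - {x}) = r" "\<exists>a\<in>T2 - {x}. (x, a) \<in> E"
    using big[OF e(2) e(4) V(2)] by blast
  obtain a b where ab: "a \<in> T1 - {x}" "(x, a) \<in> E" "b \<in> T2 - {x}" "(x, b) \<in> E"
    using T1(6) T2(6) by blast
  let ?U = "(T1 - {x}) \<union> (T2 - {x})"
  have "a = b \<or> (a, b) \<in> E" using clique ab by blast
  then have "conn E ?U" by (intro conn_Un[OF sym T1(4) T2(4) ab(1) ab(3)])
  moreover have "?U \<subseteq> S \<union> (e1 \<union> e2 - {x})" using T1(1) T2(1) by blast
  ultimately have "card ?U \<le> r" by (intro indep_setsD[OF K])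
  moreover have finU: "finite ?U"
    using T1(1) T2(1) V fin by (meson finite_Diff finite_Un finite_subset)
  \<comment> \<open>The union has at most \<open>r\<close> vertices and both parts have exactly
    \<open>r\<close>, so the parts coincide; this forces \<open>e1 = e2\<close>.\<close>
  ultimately have "card ?U \<le> card (T1 - {x})" "card ?U \<le> card (T2 - {x})"
    using T1(5) T2(5) by simp_all
  then have "T1 - {x} = ?U" "T2 - {x} = ?U"
    by (intro card_seteq[OF finU]; blast)+
  then have "T1 = T2" using T1(3) T2(3) by (metis insert_Diff)
  then show False using T1(2) T2(2) e(5) by simp
qed (use x in simp_all)

section \<open>Block graphs as relations\<close>

text \<open>\<open>nbrs_adj\<close> is the form in which completeness of blocks is used: two
  distinct neighbours of \<open>c\<close> joined by a path around \<open>c\<close> lie with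
  \<open>c\<close> on a cycle, hence in one block.\<close>

locale block_rel =
  fixes V :: "'a set" and E :: "'a rel"
  assumes finite_V: "finite V" and E_sub: "E \<subseteq> V \<times> V" and sym_E: "sym E"
    and irrefl_E: "(a, a) \<notin> E"
    and nbrs_adj: "(c, p) \<in> E \<Longrightarrow> (c, q) \<in> E \<Longrightarrow> (p, q) \<in> (Restr E (V - {c}))\<^sup>*
                    \<Longrightarrow> p = q \<or> (p, q) \<in> E"
begin

lemma E_commute: "(a, b) \<in> E \<longleftrightarrow> (b, a) \<in> E"
  using sym_E by (auto dest: symD)

lemma E_V: "(a, b) \<in> E \<Longrightarrow> a \<in> V \<and> b \<in> V"
  using E_sub by auto

text \<open>The path around \<open>c\<close> has the single inner vertex \<open>z\<close>; by
  symmetry, every 4-cycle has both diagonals.\<close>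

lemma nbrs_adj_path2:
  assumes "(c, p) \<in> E" "(c, q) \<in> E" "(p, z) \<in> E" "(z, q) \<in> E" "z \<noteq> c"
  shows "p = q \<or> (p, q) \<in> E"
proof (rule nbrs_adj[OF assms(1,2)])
  have "p \<noteq> c" "q \<noteq> c" using assms(1,2) irrefl_E by auto
  then have "(p, z) \<in> Restr E (V - {c})" "(z, q) \<in> Restr E (V - {c})"
    using assms E_V by auto
  then show "(p, q) \<in> (Restr E (V - {c}))\<^sup>*" by (meson r_into_rtrancl rtrancl_into_rtrancl)
qed

section \<open>Distances and the centre\<close>

definition dist :: "'a \<Rightarrow> 'a \<Rightarrow> nat" where
  "dist a b = (LEAST n. (a, b) \<in> E ^^ n)"

lemma dist_le: "(a, b) \<in> E ^^ n \<Longrightarrow> dist a b \<le> n"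
  unfolding dist_def by (rule Least_le)

lemma relpow_commute: "(a, b) \<in> E ^^ n \<Longrightarrow> (b, a) \<in> E ^^ n"
proof (induction n arbitrary: b)
  case (Suc n)
  then obtain c where "(a, c) \<in> E ^^ n" "(c, b) \<in> E" by auto
  then have "(c, a) \<in> E ^^ n" "(b, c) \<in> E" using Suc.IH E_commute by auto
  then show ?case by (meson relpow_Suc_I2)
qed simp

text \<open>If the walk met \<open>c\<close>, its remaining part would reach \<open>a\<close> from
  \<open>c\<close> in at most \<open>n\<close> steps.\<close>

lemma short_walk_avoids:
  assumes "(p, a) \<in> E ^^ n" "n < dist c a"
  shows "(p, a) \<in> (Restr E (V - {c}))\<^sup>*"
  using assms
proof (induction n arbitrary: p)
  case (Suc n)
  obtain p' where p': "(p, p') \<in> E" "(p', a) \<in> E ^^ n" using Suc.prems(1) by (meson relpow_Suc_D2)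
  have "p \<noteq> c" using dist_le[OF Suc.prems(1)] Suc.prems(2) by auto
  moreover have "p' \<noteq> c" using dist_le[OF p'(2)] Suc.prems(2) by auto
  ultimately have "(p, p') \<in> Restr E (V - {c})" using p'(1) E_V by auto
  moreover have "(p', a) \<in> (Restr E (V - {c}))\<^sup>*" using Suc.IH[OF p'(2)] Suc.prems(2) by simp
  ultimately show ?case by (rule converse_rtrancl_into_rtrancl)
qed simp

text \<open>The reason is that \<open>v'\<close> separates \<open>a\<close> from \<open>b\<close>.\<close>

lemma dist_through:
  assumes vv': "(v, v') \<in> E"
    and walks: "(v', a) \<in> E ^^ dist v' a" "(v, b) \<in> E ^^ dist v b" "(a, b) \<in> E ^^ dist a b"
    and a: "dist v' a < dist v a" and b: "dist v b \<le> dist v' b"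
  shows "dist v' a + dist v' b \<le> dist a b"
proof (rule ccontr)
  assume less: "\<not> ?thesis"
  let ?R = "Restr E (V - {v'})"
  obtain f where f: "f 0 = a" "f (dist a b) = b" "\<And>i. i < dist a b \<Longrightarrow> (f i, f (Suc i)) \<in> E"
    using walks(3) unfolding relpow_fun_conv by blast
  have av: "(a, f i) \<in> E ^^ i" if "i \<le> dist a b" for i
    using that by (induction i) (use f in \<open>auto intro: relpow_Suc_I\<close>)
  have vb: "(f (dist a b - i), b) \<in> E ^^ i" if "i \<le> dist a b" for i
    using that
  proof (induction i)
    case (Suc i)
    then have "(f (dist a b - Suc i), f (dist a b - i)) \<in> E"
      using f(3)[of "dist a b - Suc i"] by (simp add: Suc_diff_Suc)
    then show ?case using Suc by (intro relpow_Suc_I2) auto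
  qed (use f in simp)
  \<comment> \<open>If the shortest path from \<open>a\<close> to \<open>b\<close> met
    \<open>v'\<close>, its two pieces would have lengths at least \<open>dist v' a\<close> and
    \<open>dist v' b\<close>.\<close>
  have avoid: "f i \<noteq> v'" if "i \<le> dist a b" for i
  proof
    assume "f i = v'"
    then have "dist v' a \<le> i" "dist v' b \<le> dist a b - i"
      using dist_le[OF relpow_commute[OF av[OF that]]] dist_le[OF vb[of "dist a b - i"]] that
      by auto
    then show False using less that by simp
  qed
  have ab: "(a, f i) \<in> ?R\<^sup>*" if "i \<le> dist a b" for i
    using that
  proof (induction i)
    case (Suc i)
    then have "(f i, f (Suc i)) \<in> ?R" using f(3)[of i] avoid[of i] avoid[of "Suc i"] E_V by auto
    moreover have "(a, f i) \<in> ?R\<^sup>*" using Suc by simp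
    ultimately show ?case by (rule rtrancl_into_rtrancl[rotated])
  qed (use f in simp)
  have "a \<noteq> v'" using avoid[of 0] f by simp
  have "dist v' a \<noteq> 0"
  proof
    assume "dist v' a = 0"
    then show False using walks(1) \<open>a \<noteq> v'\<close> by simp
  qed
  then obtain k where k: "dist v' a = Suc k" using not0_implies_Suc by blast
  then obtain p where p: "(v', p) \<in> E" "(p, a) \<in> E ^^ k" using walks(1) by (metis relpow_Suc_D2)
  have pa: "(p, a) \<in> ?R\<^sup>*" using k by (intro short_walk_avoids[OF p(2)]) simp
  have "v \<noteq> v'" using vv' irrefl_E by auto
  \<comment> \<open>A shortest walk from \<open>v\<close> to \<open>b\<close> never meets
    \<open>v'\<close>: after its first step, less than \<open>dist v' b\<close> remains.\<close>
  have vb': "(v, b) \<in> ?R\<^sup>*"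
  proof (cases "dist v b")
    case 0
    then show ?thesis using walks(2) by simp
  next
    case (Suc m)
    then obtain w where w: "(v, w) \<in> E" "(w, b) \<in> E ^^ m" using walks(2) by (metis relpow_Suc_D2)
    have "w \<noteq> v'" using dist_le[OF w(2)] Suc b by auto
    then have "(v, w) \<in> ?R" using w(1) \<open>v \<noteq> v'\<close> E_V by auto
    moreover have "(w, b) \<in> ?R\<^sup>*" using Suc b by (intro short_walk_avoids[OF w(2)]) simp
    ultimately show ?thesis by (rule converse_rtrancl_into_rtrancl)
  qed
  have "(p, b) \<in> ?R\<^sup>*" using pa ab[of "dist a b"] f(2) by auto
  moreover have "(b, v) \<in> ?R\<^sup>*" by (rule sym_rtrancl_Restr[OF sym_E vb'])
  ultimately have "(p, v) \<in> ?R\<^sup>*" by (rule rtrancl_trans)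
  \<comment> \<open>\<open>p\<close> and \<open>v\<close> are neighbours of \<open>v'\<close> joined
    around it. Going directly from \<open>v\<close> to \<open>p\<close> shows that \<open>a\<close>
    is no farther from \<open>v\<close> than from \<open>v'\<close>.\<close>
  then have "p = v \<or> (p, v) \<in> E" using nbrs_adj[OF p(1)] vv' E_commute by blast
  then have "dist v a \<le> Suc k"
  proof
    assume "p = v"
    then show ?thesis using dist_le[OF p(2)] by simp
  next
    assume "(p, v) \<in> E"
    then have "(v, a) \<in> E ^^ Suc k" using p(2) E_commute by (meson relpow_Suc_I2)
    then show ?thesis by (rule dist_le)
  qed
  then show False using a k by simp
qed

text \<open>
  A vertex minimising the total excess of the distances over 2: if \<open>a\<close> were at distance at least 3,
  a step towards \<open>a\<close> would lower its excess and, by \<open>dist_through\<close>, not raise any other.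
\<close>

lemma ex_center:
  assumes ne: "V \<noteq> {}" and diam: "\<And>a b. a \<in> V \<Longrightarrow> b \<in> V \<Longrightarrow> \<exists>n\<le>4. (a, b) \<in> E ^^ n"
  obtains v where "v \<in> V" "\<And>u. u \<in> V \<Longrightarrow> u = v \<or> (v, u) \<in> E \<or> (\<exists>w. (v, w) \<in> E \<and> (w, u) \<in> E)"
proof -
  have walk: "(a, b) \<in> E ^^ dist a b" if "a \<in> V" "b \<in> V" for a b
    using diam[OF that] unfolding dist_def by (meson LeastI)
  have le4: "dist a b \<le> 4" if "a \<in> V" "b \<in> V" for a b
    using diam[OF that] dist_le le_trans by blast
  \<comment> \<open>The subtraction is truncated, so vertices within distance 2 contribute
    nothing.\<close>
  let ?ex = "\<lambda>v. \<Sum>b\<in>V. dist v b - 2"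
  obtain v0 where "v0 \<in> V" using ne by blast
  from ex_has_least_nat[of "\<lambda>v. v \<in> V" v0 ?ex, OF this]
  obtain v where v: "v \<in> V" "\<And>u. u \<in> V \<Longrightarrow> ?ex v \<le> ?ex u" by blast
  have le2: "dist v a \<le> 2" if a: "a \<in> V" for a
  proof (rule ccontr)
    assume "\<not> dist v a \<le> 2"
    then obtain k where k: "dist v a = Suc k" "k \<ge> 2"
      by (metis Suc_le_mono not_less_eq_eq numeral_2_eq_2 old.nat.exhaust zero_le)
    then obtain v' where v': "(v, v') \<in> E" "(v', a) \<in> E ^^ k"
      using walk[OF v(1) a] by (metis relpow_Suc_D2)
    have v'V: "v' \<in> V" using v'(1) E_V by blast
    have "(v, a) \<in> E ^^ Suc (dist v' a)" using v'(1) walk[OF v'V a] by (rule relpow_Suc_I2)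
    from dist_le[OF this] have "dist v' a = k" using dist_le[OF v'(2)] k by simp
    have "dist v' b - 2 \<le> dist v b - 2" if b: "b \<in> V" for b
    proof (cases "dist v b \<le> dist v' b")
      case True
      \<comment> \<open>The diameter bound enters here: \<open>dist v' a\<close> is at least 2,
        which leaves at most 2 for \<open>dist v' b\<close>.\<close>
      have "dist v' a + dist v' b \<le> dist a b"
        using True k \<open>dist v' a = k\<close> walk v(1) v'V a b by (intro dist_through[OF v'(1)]) auto
      then have "dist v' b \<le> 2" using le4[OF a b] \<open>dist v' a = k\<close> k by simp
      then show ?thesis by simp
    qed simp
    moreover have "dist v' a - 2 < dist v a - 2" using k \<open>dist v' a = k\<close> by simp
    ultimately have "?ex v' < ?ex v" using a by (intro sum_strict_mono_ex1[OF finite_V]) auto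
    then show False using v(2)[OF v'V] by simp
  qed
  show ?thesis
  proof (rule that[OF v(1)])
    fix u assume u: "u \<in> V"
    have "dist v u = 0 \<or> dist v u = 1 \<or> dist v u = 2" using le2[OF u] by linarith
    then show "u = v \<or> (v, u) \<in> E \<or> (\<exists>w. (v, w) \<in> E \<and> (w, u) \<in> E)"
      using walk[OF v(1) u] by (auto simp: numeral_2_eq_2)
  qed
qed

end

section \<open>Block graphs of radius at most two\<close>

locale radius2_block_rel = block_rel +
  fixes v :: 'a
  assumes v_V: "v \<in> V"
    and near: "u \<in> V \<Longrightarrow> u = v \<or> (v, u) \<in> E \<or> (\<exists>w. (v, w) \<in> E \<and> (w, u) \<in> E)"
begin

definition N :: "'a set" where "N = {u. (v, u) \<in> E}"

text \<open>By \<open>near\<close>, these are the vertices at distance exactly 2 from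
  \<open>v\<close>.\<close>

definition L :: "'a set" where "L = V - insert v N"

lemma N_V: "N \<subseteq> V" and v_N: "v \<notin> N"
  using E_V irrefl_E by (auto simp: N_def)

lemma L_parent: "d \<in> L \<Longrightarrow> \<exists>u\<in>N. (u, d) \<in> E"
  using near[of d] by (auto simp: L_def N_def)

text \<open>With two parents \<open>u\<close> and \<open>u'\<close>, the vertices \<open>d\<close>,
  \<open>u\<close>, \<open>v\<close>, \<open>u'\<close> would form a 4-cycle, whose diagonal joins
  \<open>d\<close> to \<open>v\<close>.\<close>

lemma L_unique_parent:
  assumes d: "d \<in> L" and u: "u \<in> N" "(u, d) \<in> E" and u': "u' \<in> N" "(u', d) \<in> E"
  shows "u = u'"
proof (rule ccontr)
  assume ne: "u \<noteq> u'"
  have uv: "(u, v) \<in> E" "(v, u) \<in> E" "(u', v) \<in> E" "(v, u') \<in> E"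
    using u(1) u'(1) E_commute by (auto simp: N_def)
  have "(d, u) \<in> E" "(d, u') \<in> E" using u u' E_commute by auto
  moreover have "v \<noteq> d" using d by (auto simp: L_def)
  ultimately have "(u, u') \<in> E" using nbrs_adj_path2[of d u u' v] uv ne by auto
  then have "d = v \<or> (d, v) \<in> E"
    using nbrs_adj_path2[of u d v u'] u u' uv ne \<open>(d, u') \<in> E\<close> by auto
  then show False using d E_commute by (auto simp: L_def N_def)
qed

text \<open>From \<open>d'\<close> one gets to \<open>u\<close> by way of its own parent and
  \<open>v\<close>, avoiding \<open>d\<close>; so the neighbours \<open>u\<close> and
  \<open>d'\<close> of \<open>d\<close> share a block with it.\<close>

lemma L_adj_parent:
  assumes d: "d \<in> L" "d' \<in> L" "(d, d') \<in> E" and u: "u \<in> N" "(u, d) \<in> E"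
  shows "(u, d') \<in> E"
proof -
  obtain u' where u': "u' \<in> N" "(u', d') \<in> E" using L_parent d(2) by blast
  have dN: "d \<notin> N" "d' \<notin> N" "d \<noteq> v" "d' \<noteq> v" using d by (auto simp: L_def)
  have steps: "(u, v) \<in> Restr E (V - {d})" "(v, u') \<in> Restr E (V - {d})"
    "(u', d') \<in> Restr E (V - {d})"
    using u u' d dN v_N E_V irrefl_E E_commute by (auto simp: N_def)
  then have "(u, d') \<in> (Restr E (V - {d}))\<^sup>*" by (meson r_into_rtrancl rtrancl_into_rtrancl)
  then have "u = d' \<or> (u, d') \<in> E" using nbrs_adj[of d u d'] u(2) d(3) E_commute by blast
  then show ?thesis using dN u by auto
qed

text \<open>Paths of length at most 2 from \<open>v\<close> have inner vertices in \<open>N\<close>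
  and so avoid \<open>d\<close>. Hence any two neighbours of \<open>d\<close> are joined around
  \<open>d\<close>, through \<open>v\<close>.\<close>

lemma L_simplicial:
  assumes d: "d \<in> L" and ab: "(d, a) \<in> E" "(d, b) \<in> E" "a \<noteq> b"
  shows "(a, b) \<in> E"
proof -
  have to_v: "(v, c) \<in> (Restr E (V - {d}))\<^sup>*" if c: "(d, c) \<in> E" for c
  proof -
    have dv: "d \<noteq> v" "d \<notin> N" using d by (auto simp: L_def)
    have cd: "c \<in> V" "c \<noteq> d" using c E_V irrefl_E by auto
    from near[OF cd(1)] show ?thesis
    proof (elim disjE exE conjE)
      assume "(v, c) \<in> E"
      then show ?thesis using dv cd v_V by auto
    next
      fix w assume w: "(v, w) \<in> E" "(w, c) \<in> E"
      then have "w \<noteq> d" using dv by (auto simp: N_def)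
      then have "(v, w) \<in> Restr E (V - {d})" "(w, c) \<in> Restr E (V - {d})"
        using w dv cd v_V E_V by auto
      then show ?thesis by (meson r_into_rtrancl rtrancl_into_rtrancl)
    qed simp
  qed
  have "(a, b) \<in> (Restr E (V - {d}))\<^sup>*"
    using sym_rtrancl_Restr[OF sym_E to_v[OF ab(1)]] to_v[OF ab(2)] by (rule rtrancl_trans)
  then show ?thesis using nbrs_adj[OF ab(1,2)] ab(3) by blast
qed

section \<open>Branches at the centre and the exchange of neighbours\<close>

text \<open>The vertex \<open>u\<close> counts whether or not it is in \<open>S\<close>: the set is
  what a connected set gains at most by using \<open>u\<close> when its vertices at distance 2 must
  come from \<open>S\<close>.\<close>

definition branch :: "'a set \<Rightarrow> 'a \<Rightarrow> 'a set" where
  "branch S u = insert u {d \<in> S \<inter> L. (u, d) \<in> E}"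

lemma branch_disjoint:
  assumes "u \<in> N" "u' \<in> N" "u \<noteq> u'"
  shows "branch S u \<inter> branch S u' = {}"
proof (rule equals0I)
  fix z assume z: "z \<in> branch S u \<inter> branch S u'"
  have "z \<notin> N" if "z \<in> L" using that by (auto simp: L_def)
  then have "z \<in> L" "(u, z) \<in> E" "(u', z) \<in> E" using z assms by (auto simp: branch_def)
  then show False using L_unique_parent assms by blast
qed

lemma branch_V: "u \<in> N \<Longrightarrow> branch S u \<subseteq> V - {v}"
  using N_V v_N by (auto simp: branch_def L_def)

lemma card_branches:
  assumes "U \<subseteq> N"
  shows "card (\<Union>u\<in>U. branch S u) = (\<Sum>u\<in>U. card (branch S u))"
proof (rule card_UN_disjoint)
  show "finite U" using assms N_V finite_V by (meson finite_subset)
  show "\<forall>u\<in>U. finite (branch S u)"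
    using assms branch_V finite_V by (meson finite_Diff finite_subset subsetD)
qed (use assms branch_disjoint in blast)

text \<open>A walk that starts in \<open>N\<close> can enter \<open>L\<close> only from a parent,
  and moving within \<open>L\<close> keeps the parent. So the parents of all vertices of
  \<open>T\<close> in \<open>L\<close> belong to \<open>T\<close>.\<close>

lemma conn_subset_branches:
  assumes T: "conn E T" "T \<subseteq> V" "T \<inter> L \<subseteq> S" and x: "x \<in> T" "x \<in> N"
  shows "T - {v} \<subseteq> (\<Union>u\<in>T \<inter> N. branch S u)"
proof -
  have "z \<in> L \<longrightarrow> (\<exists>u\<in>T \<inter> N. (u, z) \<in> E)" if "(x, z) \<in> (Restr E T)\<^sup>*" for z
    using that
  proof (induction rule: rtrancl_induct)
    case base
    then show ?case using x by (auto simp: L_def)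
  next
    case (step z z')
    have z: "(z, z') \<in> E" "z \<in> T" "z' \<in> T" "z \<in> V" using step.hyps(2) T(2) by auto
    show ?case
    proof
      assume z': "z' \<in> L"
      then have "z \<noteq> v" using z(1) by (auto simp: L_def N_def)
      show "\<exists>u\<in>T \<inter> N. (u, z') \<in> E"
      proof (cases "z \<in> N")
        case True
        then show ?thesis using z by blast
      next
        case False
        then have "z \<in> L" using z(4) \<open>z \<noteq> v\<close> by (simp add: L_def)
        then show ?thesis using step.IH L_adj_parent[OF _ z' z(1)] by blast
      qed
    qed
  qed
  then have parent: "\<exists>u\<in>T \<inter> N. (u, z) \<in> E" if "z \<in> T" "z \<in> L" for z
    using that T(1) x(1) by (auto simp: conn_def)
  show ?thesis
  proof
    fix z assume z: "z \<in> T - {v}"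
    show "z \<in> (\<Union>u\<in>T \<inter> N. branch S u)"
    proof (cases "z \<in> N")
      case True
      then show ?thesis using z by (auto simp: branch_def)
    next
      case False
      then have "z \<in> L" using z T(2) by (auto simp: L_def)
      then show ?thesis using parent[of z] z T(3) by (auto simp: branch_def)
    qed
  qed
qed

text \<open>
  Whether a set containing \<open>v\<close>, or lying inside one block at \<open>v\<close> with the branches attached to it,
  is connected does not depend on which neighbours of \<open>v\<close> it uses; only the sizes of the branches
  matter.
\<close>

lemma exchange:
  assumes T: "conn E T" "T \<subseteq> V" "T \<inter> L \<subseteq> S" and S: "x \<notin> S"
    and x: "x \<in> T" "x \<in> N" and y: "y \<in> N" "y \<notin> T"
    and le: "card (branch S x) \<le> card (branch S y)"
    and adj: "v \<in> T \<or> (x, y) \<in> E"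
  shows "\<exists>T'. conn E T' \<and> T' \<subseteq> insert y (T - {x}) \<union> S \<and> card T \<le> card T'"
proof -
  define U where "U = T \<inter> N - {x}"
  define B where "B = (\<Union>u\<in>insert y U. branch S u)"
  \<comment> \<open>The branches are taken in full, not only their part in \<open>T\<close>. This
    costs nothing, as they add only vertices of \<open>S\<close>, and makes the sizes
    comparable.\<close>
  define T' where "T' = (T \<inter> {v}) \<union> B"
  have UN: "insert y U \<subseteq> N" "insert x U \<subseteq> N" using x y by (auto simp: U_def)
  have finU: "finite U" using finite_V N_V by (auto simp: U_def intro: finite_subset)
  have yU: "y \<notin> U" "x \<notin> U" "y \<noteq> x" using x y by (auto simp: U_def)
  have vB: "v \<notin> B" using UN branch_V unfolding B_def by blast
  have finB: "finite B" using UN branch_V finite_V unfolding B_def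
    by (meson UN_least finite_Diff finite_subset subsetD)
  have "T - {v} \<subseteq> (\<Union>u\<in>T \<inter> N. branch S u)" by (rule conn_subset_branches[OF T x])
  also have "T \<inter> N = insert x U" using x by (auto simp: U_def)
  finally have "card (T - {v}) \<le> card (\<Union>u\<in>insert x U. branch S u)"
    using UN branch_V finite_V
    by (intro card_mono) (meson UN_least finite_Diff finite_subset subsetD, blast)
  \<comment> \<open>Branches are disjoint, so the two sums differ only in the terms of
    \<open>x\<close> and \<open>y\<close>.\<close>
  also have "\<dots> \<le> card B"
    unfolding B_def card_branches[OF UN(1)] card_branches[OF UN(2)] using finU yU le by simp
  finally have TB: "card (T - {v}) \<le> card B" .
  have "finite T" using T(2) finite_V by (rule finite_subset)
  then have "card T \<le> card T'"
    using TB vB finB by (cases "v \<in> T") (auto simp: T'_def card_Diff_singleton)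
  moreover have "T' \<subseteq> insert y (T - {x}) \<union> S"
    using v_N x by (auto simp: T'_def B_def branch_def U_def)
  moreover have "conn E T'"
  proof -
    have sub: "branch S u \<subseteq> T'" if "u \<in> insert y U" for u using that by (auto simp: T'_def B_def)
    have in_branch: "(u, z) \<in> (Restr E T')\<^sup>*" if "u \<in> insert y U" "z \<in> branch S u" for u z
      using that sub[OF that(1)] by (auto simp: branch_def)
    have mem: "u \<in> T'" if "u \<in> insert y U" for u using sub[OF that] by (auto simp: branch_def)
    show ?thesis
    proof (cases "v \<in> T")
      case True
      then have vT': "v \<in> T'" by (simp add: T'_def)
      show ?thesis
      proof (rule connI[OF sym_E vT'])
        fix z assume "z \<in> T'"
        then consider "z = v" | u where "u \<in> insert y U" "z \<in> branch S u"
          by (auto simp: T'_def B_def)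
        then show "(v, z) \<in> (Restr E T')\<^sup>*"
        proof cases
          case (2 u)
          then have "(v, u) \<in> Restr E T'" using vT' mem UN by (auto simp: N_def)
          then show ?thesis using in_branch[OF 2] by (rule converse_rtrancl_into_rtrancl)
        qed simp
      qed
    next
      case False
      \<comment> \<open>Without \<open>v\<close>, connectedness of \<open>T\<close> puts
        \<open>x\<close> and \<open>u\<close> in one block at \<open>v\<close>; as \<open>y\<close>
        is adjacent to \<open>x\<close>, it lies in the same block.\<close>
      have adj_y: "(y, u) \<in> E" if "u \<in> U" for u
      proof -
        have "(x, u) \<in> (Restr E T)\<^sup>*" using T(1) x that by (auto simp: conn_def U_def)
        then have "(x, u) \<in> (Restr E (V - {v}))\<^sup>*"
          by (rule rtrancl_Restr_mono[rotated]) (use T(2) False in blast)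
        then have "x = u \<or> (x, u) \<in> E" using nbrs_adj[of v x u] x that by (auto simp: N_def U_def)
        then have "(x, u) \<in> E" using that by (auto simp: U_def)
        moreover have "(y, x) \<in> E" using adj False E_commute by blast
        moreover have "x \<noteq> v" using x v_N by blast
        moreover have "y \<noteq> u" using that yU by blast
        ultimately show ?thesis
          using nbrs_adj_path2[of v y u x] y that by (auto simp: N_def U_def)
      qed
      show ?thesis
      proof (rule connI[OF sym_E mem[of y]])
        fix z assume "z \<in> T'"
        then obtain u where u: "u \<in> insert y U" "z \<in> branch S u"
          using False by (auto simp: T'_def B_def)
        have "(y, u) \<in> (Restr E T')\<^sup>*"
        proof (cases "u = y")
          case False
          then have "(y, u) \<in> Restr E T'" using u(1) adj_y mem by auto
          then show ?thesis by blast
        qed simp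
        then show "(y, z) \<in> (Restr E T')\<^sup>*" using in_branch[OF u] by (rule rtrancl_trans)
      qed simp
    qed
  qed
  ultimately show ?thesis by blast
qed

text \<open>A circuit through \<open>x\<close> lies in a connected set with more than
  \<open>r\<close> vertices, the others being in \<open>S\<close>. Since the branch of
  \<open>x\<close> is smallest, exchanging \<open>x\<close> for a vertex of the second circuit
  yields a connected set at least as large. It avoids \<open>x\<close>, so the two circuits without
  \<open>x\<close> still form a non-face over \<open>S\<close>.\<close>

lemma link_simplicial_min_branch:
  assumes S: "S \<in> indep_sets V E r" and x: "x \<in> N" "x \<notin> S" "insert x S \<in> indep_sets V E r"
    and no_leaf: "\<And>d. d \<in> L \<Longrightarrow> d \<notin> S \<Longrightarrow> insert d S \<notin> indep_sets V E r"
    and min: "\<And>y. y \<in> N \<Longrightarrow> y \<notin> S \<Longrightarrow> insert y S \<in> indep_sets V E r \<Longrightarrow>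
                card (branch S x) \<le> card (branch S y)"
  shows "link_simplicial (indep_sets V E r) S x"
proof -
  let ?K = "indep_sets V E r"
  have down: "A \<in> ?K" if "B \<in> ?K" "A \<subseteq> B" for A B using that by (auto simp: indep_sets_def)
  \<comment> \<open>For \<open>y\<close> other than \<open>x\<close>, the face
    \<open>S \<union> (e - {x})\<close> contains \<open>y\<close>; so every vertex of a circuit
    through \<open>x\<close> extends \<open>S\<close> to a face.\<close>
  have vertex: "y \<notin> S \<and> insert y S \<in> ?K" if e: "link_circuit ?K S e" "x \<in> e" and "y \<in> e" for e y
  proof
    show "y \<notin> S" using that by (auto simp: link_circuit_def)
    show "insert y S \<in> ?K"
    proof (cases "y = x")
      case False
      have "S \<union> (e - {x}) \<in> ?K" using e by (auto simp: link_circuit_def)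
      then show ?thesis by (rule down) (use False \<open>y \<in> e\<close> in blast)
    qed (use x in simp)
  qed
  have circuit: "\<exists>T. T \<subseteq> S \<union> e \<and> e \<subseteq> T \<and> conn E T \<and> r < card T \<and> T \<subseteq> V \<and> T \<inter> L \<subseteq> S"
    if e: "link_circuit ?K S e" "x \<in> e" for e
  proof -
    have eV: "S \<union> e \<subseteq> V" using vertex[OF e] S by (auto simp: indep_sets_def)
    obtain T where T: "T \<subseteq> S \<union> e" "conn E T" "r < card T"
      using not_indep_setsE[OF _ eV] e(1) by (auto simp: link_circuit_def)
    have "e \<subseteq> T"
    proof
      fix z assume "z \<in> e"
      then have "S \<union> (e - {z}) \<in> ?K" using e by (auto simp: link_circuit_def)
      then have "\<not> T \<subseteq> S \<union> (e - {z})" using indep_setsD[OF _ _ T(2)] T(3) by (meson not_le)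
      then show "z \<in> T" using T(1) by blast
    qed
    \<comment> \<open>No vertex of \<open>L\<close> extends \<open>S\<close>, so the circuit itself
      has no vertex in \<open>L\<close>.\<close>
    moreover have "T \<inter> L \<subseteq> S" using T(1) vertex[OF e] no_leaf by blast
    ultimately show ?thesis using T eV by blast
  qed
  have main: False
    if e1: "link_circuit ?K S e1" "x \<in> e1" and e2: "link_circuit ?K S e2" "x \<in> e2"
      and y: "y \<in> e2" "y \<notin> e1" "y \<noteq> v"
      and T: "T \<subseteq> S \<union> e1" "e1 \<subseteq> T" "conn E T" "r < card T" "T \<subseteq> V" "T \<inter> L \<subseteq> S"
      and adj: "v \<in> T \<or> (x, y) \<in> E"
      and K: "S \<union> (e1 \<union> e2 - {x}) \<in> ?K"
    for e1 e2 y T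
  proof -
    have yS: "y \<notin> S" "insert y S \<in> ?K" using vertex[OF e2 y(1)] by auto
    then have "y \<in> V" by (simp add: indep_sets_def)
    then have yN: "y \<in> N" using no_leaf[of y] yS y(3) by (auto simp: L_def)
    have "y \<notin> T" using T(1) y yS by blast
    have "x \<in> T" using T(2) e1(2) by blast
    obtain T' where T': "conn E T'" "T' \<subseteq> insert y (T - {x}) \<union> S" "card T \<le> card T'"
      using exchange[OF T(3,5,6) x(2) \<open>x \<in> T\<close> x(1) yN \<open>y \<notin> T\<close> min[OF yN yS] adj] by blast
    have "y \<noteq> x" using y(2) e1(2) by blast
    then have "T' \<subseteq> S \<union> (e1 \<union> e2 - {x})" using T'(2) T(1) y(1) by blast
    from indep_setsD[OF K this T'(1)] show False using T'(3) T(4) by simp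
  qed
  have antichain: "\<exists>y\<in>e2. y \<notin> e1"
    if e: "link_circuit ?K S e1" "link_circuit ?K S e2" "e1 \<noteq> e2" for e1 e2
  proof (rule ccontr)
    assume "\<not> ?thesis"
    then obtain z where z: "z \<in> e1" "z \<notin> e2" "e2 \<subseteq> e1" using e(3) by blast
    then have "S \<union> (e1 - {z}) \<in> ?K" using e(1) by (auto simp: link_circuit_def)
    then have "S \<union> e2 \<in> ?K" by (rule down) (use z in blast)
    then show False using e(2) by (simp add: link_circuit_def)
  qed
  show ?thesis
    unfolding link_simplicial_def
  proof (intro conjI allI impI notI)
    fix e1 e2
    assume e: "link_circuit ?K S e1" "link_circuit ?K S e2" "x \<in> e1" "x \<in> e2" "e1 \<noteq> e2"
      and K: "S \<union> (e1 \<union> e2 - {x}) \<in> ?K"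
    have K': "S \<union> (e2 \<union> e1 - {x}) \<in> ?K" using K by (simp add: Un_commute)
    obtain T1 where T1: "T1 \<subseteq> S \<union> e1" "e1 \<subseteq> T1" "conn E T1" "r < card T1" "T1 \<subseteq> V"
      "T1 \<inter> L \<subseteq> S" using circuit[OF e(1,3)] by blast
    obtain T2 where T2: "T2 \<subseteq> S \<union> e2" "e2 \<subseteq> T2" "conn E T2" "r < card T2" "T2 \<subseteq> V"
      "T2 \<inter> L \<subseteq> S" using circuit[OF e(2,4)] by blast
    obtain y1 where y1: "y1 \<in> e1" "y1 \<notin> e2" using antichain[OF e(2,1)] e(5) by blast
    obtain y2 where y2: "y2 \<in> e2" "y2 \<notin> e1" using antichain[OF e(1,2,5)] by blast
    have notin: "y \<notin> T" if "y \<in> e" "y \<notin> e'" "T \<subseteq> S \<union> e'" "link_circuit ?K S e" for y e e' T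
      using that by (auto simp: link_circuit_def)
    show False
    \<comment> \<open>If one of the two connected sets contains \<open>v\<close>, the exchange is
      made there; the new vertex is outside that set and so is not \<open>v\<close>. If neither
      does, connectedness of \<open>T2\<close> off \<open>v\<close> makes \<open>x\<close> and
      \<open>y2\<close> adjacent, which allows the exchange in \<open>T1\<close>.\<close>
    proof (cases "v \<in> T1")
      case True
      then have "y2 \<noteq> v" using notin[OF y2 T1(1) e(2)] by blast
      then show False using main[OF e(1,3) e(2,4) y2 _ T1 _ K] True by blast
    next
      case v1: False
      show False
      proof (cases "v \<in> T2")
        case True
        then have "y1 \<noteq> v" using notin[OF y1 T2(1) e(1)] by blast
        then show False using main[OF e(2,4) e(1,3) y1 _ T2 _ K'] True by blast
      next
        case False
        have y2T: "y2 \<in> T2" "x \<in> T2" using y2 T2(2) e(4) by auto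
        then have "y2 \<noteq> v" using False by blast
        have "y2 \<in> V" using y2T T2(5) by blast
        then have "y2 \<in> N"
          using no_leaf[of y2] vertex[OF e(2,4) y2(1)] \<open>y2 \<noteq> v\<close> by (auto simp: L_def)
        have "(x, y2) \<in> (Restr E T2)\<^sup>*" using T2(3) y2T by (simp add: conn_def)
        then have "(x, y2) \<in> (Restr E (V - {v}))\<^sup>*"
          by (rule rtrancl_Restr_mono[rotated]) (use T2(5) False in blast)
        then have "x = y2 \<or> (x, y2) \<in> E"
          using nbrs_adj[of v x y2] x(1) \<open>y2 \<in> N\<close> by (simp add: N_def)
        then have "(x, y2) \<in> E" using y2 e(3) by blast
        then show False using main[OF e(1,3) e(2,4) y2 \<open>y2 \<noteq> v\<close> T1 _ K] by blast
      qed
    qed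
  qed (use x in simp_all)
qed

text \<open>Vertices extending \<open>S\<close> are sought first in \<open>L\<close>, where they are
  simplicial in the graph, then in \<open>N\<close>, where one with smallest branch is taken. If
  there are none, only \<open>v\<close> remains.\<close>

lemma ex_link_simplicial:
  assumes r: "r \<ge> 1" and S: "S \<in> indep_sets V E r" "S \<notin> facets (indep_sets V E r)"
  shows "\<exists>x. link_simplicial (indep_sets V E r) S x"
proof -
  let ?K = "indep_sets V E r"
  have down: "A \<in> ?K" if "B \<in> ?K" "A \<subseteq> B" for A B using that by (auto simp: indep_sets_def)
  show ?thesis
  proof (cases "\<exists>d\<in>L. d \<notin> S \<and> insert d S \<in> ?K")
    case True
    then obtain d where "d \<in> L" "d \<notin> S" "insert d S \<in> ?K" by blast
    then show ?thesis
      using link_simplicial_if_clique[OF finite_V sym_E r, of d S] L_simplicial by blast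
  next
    case no_leaf: False
    show ?thesis
    proof (cases "\<exists>u\<in>N. u \<notin> S \<and> insert u S \<in> ?K")
      case True
      then obtain u where u: "u \<in> N \<and> u \<notin> S \<and> insert u S \<in> ?K" by blast
      from ex_has_least_nat[of "\<lambda>u. u \<in> N \<and> u \<notin> S \<and> insert u S \<in> ?K" u "\<lambda>u. card (branch S u)",
          OF this]
      obtain x where x: "x \<in> N" "x \<notin> S" "insert x S \<in> ?K"
        and min: "\<And>y. y \<in> N \<Longrightarrow> y \<notin> S \<Longrightarrow> insert y S \<in> ?K \<Longrightarrow>
                    card (branch S x) \<le> card (branch S y)" by blast
      have "link_simplicial ?K S x"
        using no_leaf by (intro link_simplicial_min_branch[OF S(1) x _ min]) blast+
      then show ?thesis by blast
    next
      case False
      obtain F where F: "F \<in> ?K" "S \<subset> F" using S by (auto simp: facets_def)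
      then obtain z where z: "z \<in> F" "z \<notin> S" by blast
      then have "insert z S \<in> ?K" using down[OF F(1), of "insert z S"] F(2) by blast
      have only: "y = v" if "y \<notin> S" "insert y S \<in> ?K" for y
      proof (rule ccontr)
        assume "y \<noteq> v"
        moreover have "y \<in> V" using that(2) by (simp add: indep_sets_def)
        ultimately show False using that no_leaf False by (auto simp: L_def)
      qed
      have v: "v \<notin> S" "insert v S \<in> ?K" using only[OF z(2) \<open>insert z S \<in> ?K\<close>] z \<open>insert z S \<in> ?K\<close>
        by auto
      \<comment> \<open>Any other vertex of such a circuit would extend \<open>S\<close> as well, so
        the circuit would be \<open>{v}\<close>, although \<open>insert v S\<close> is a face. Thus
        \<open>v\<close> is simplicial vacuously.\<close>
      have no_circuit: False if e: "link_circuit ?K S e" "v \<in> e" for e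
      proof -
        have "y = v" if "y \<in> e" for y
        proof (rule ccontr)
          assume "y \<noteq> v"
          have "S \<union> (e - {v}) \<in> ?K" using e by (auto simp: link_circuit_def)
          then have "insert y S \<in> ?K" by (rule down) (use that \<open>y \<noteq> v\<close> in blast)
          moreover have "y \<notin> S" using that e(1) by (auto simp: link_circuit_def)
          ultimately show False using only \<open>y \<noteq> v\<close> by blast
        qed
        then have "S \<union> e = insert v S" using e(2) by blast
        then show False using e(1) v by (simp add: link_circuit_def)
      qed
      have "link_simplicial ?K S v"
        unfolding link_simplicial_def using v no_circuit by blast
      then show ?thesis by blast
    qed
  qed
qed

end

section \<open>From digraphs to relations\<close>

lemma conn_singleton: "conn E {x}"
  by (simp add: conn_def)

lemma conn_mono:
  assumes "conn E T" "Restr E T \<subseteq> E'"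
  shows "conn E' T"
proof -
  have "Restr E T \<subseteq> Restr E' T" using assms(2) by blast
  then show ?thesis using assms(1) rtrancl_mono unfolding conn_def by blast
qed

text \<open>\<open>rtrancl_on\<close> is reflexive only on \<open>T\<close>, hence the assumption on
  \<open>a\<close>.\<close>

lemma rtrancl_on_iff:
  assumes "a \<in> T"
  shows "(a, b) \<in> rtrancl_on T E \<longleftrightarrow> (a, b) \<in> (Restr E T)\<^sup>*"
proof
  assume "(a, b) \<in> rtrancl_on T E"
  then show "(a, b) \<in> (Restr E T)\<^sup>*"
  proof (induction rule: rtrancl_on_induct)
    case (step y z)
    then have "(y, z) \<in> Restr E T" by blast
    with step.IH show ?case by (rule rtrancl_into_rtrancl)
  qed simp
next
  assume "(a, b) \<in> (Restr E T)\<^sup>*"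
  then show "(a, b) \<in> rtrancl_on T E"
  proof (induction rule: rtrancl_induct)
    case (step y z)
    then show ?case by (auto intro: rtrancl_on_into_rtrancl_on)
  qed (use assms in simp)
qed

lemma connected_iff_conn:
  assumes "symmetric H"
  shows "Digraph_Component.connected H \<longleftrightarrow> conn (arcs_ends H) (verts H)"
proof -
  have "symcl (arcs_ends H) = arcs_ends H"
    using assms by (auto simp: symcl_def symmetric_def dest: symD)
  then show ?thesis by (simp add: connected_conv conn_def rtrancl_on_iff)
qed

lemma arcs_ends_induce_subgraph: "arcs_ends (G \<restriction> W) = Restr (arcs_ends G) W"
  by (auto simp: arcs_ends_conv)

lemma symmetric_induce_subgraph: "symmetric G \<Longrightarrow> symmetric (G \<restriction> W)"
  by (auto simp: symmetric_def arcs_ends_induce_subgraph sym_def)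

lemma connected_induce_subgraph:
  assumes "symmetric G"
  shows "Digraph_Component.connected (G \<restriction> W) \<longleftrightarrow> conn (arcs_ends G) W"
  unfolding connected_iff_conn[OF symmetric_induce_subgraph[OF assms]]
  by (simp add: arcs_ends_induce_subgraph conn_def Int_assoc)

lemma del_vert_induce_subgraph: "pre_digraph.del_vert (G \<restriction> W) w = G \<restriction> (W - {w})"
  by (auto simp: pre_digraph.del_vert_def induce_subgraph_def)

text \<open>The set is the vertex set of a cycle: \<open>c\<close> together with a shortest path from \<open>p\<close> to \<open>q\<close>.\<close>

lemma ex_cycle_set:
  assumes sym: "sym E" and p: "(c, p) \<in> E" and q: "(c, q) \<in> E" and ne: "p \<noteq> q"
    and path: "(p, q) \<in> (Restr E (V - {c}))\<^sup>*" and cV: "c \<in> V"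
  obtains W where "W \<subseteq> V" "p \<in> W" "q \<in> W" "conn E W" "\<And>w. w \<in> W \<Longrightarrow> conn E (W - {w})"
proof -
  let ?R = "Restr E (V - {c})"
  obtain n' where "(p, q) \<in> ?R ^^ n'" using path rtrancl_imp_relpow by blast
  from ex_has_least_nat[of "\<lambda>n. (p, q) \<in> ?R ^^ n" n' "\<lambda>n. n", OF this]
  obtain n where n: "(p, q) \<in> ?R ^^ n" "\<And>m. (p, q) \<in> ?R ^^ m \<Longrightarrow> n \<le> m" by blast
  have n0: "n > 0" using n(1) ne by (cases n) auto
  obtain f where f: "f 0 = p" "f n = q" "\<And>i. i < n \<Longrightarrow> (f i, f (Suc i)) \<in> ?R"
    using n(1) unfolding relpow_fun_conv by blast
  have fV: "f i \<in> V - {c}" if "i \<le> n" for i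
    using that f(3)[of i] f(3)[of "i - 1"] n0 by (cases "i = n") auto
  have walk: "(f i, f j) \<in> ?R ^^ (j - i)" if "i \<le> j" "j \<le> n" for i j
    unfolding relpow_fun_conv
    by (rule exI[of _ "\<lambda>k. f (i + k)"]) (use that f(3) in auto)
  \<comment> \<open>A repeated vertex would allow the part between its occurrences to be cut out,
    against the minimality of \<open>n\<close>.\<close>
  have inj: "f i \<noteq> f j" if "i < j" "j \<le> n" for i j
  proof
    assume eq: "f i = f j"
    have "(p, f i) \<in> ?R ^^ i" using walk[of 0 i] that f(1) by simp
    moreover have "(f i, q) \<in> ?R ^^ (n - j)" using walk[of j n] that f(2) eq by simp
    ultimately have "(p, q) \<in> ?R ^^ (i + (n - j))" by (auto simp: relpow_add)
    from n(2)[OF this] that show False by simp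
  qed
  have edge: "(f i, f (Suc i)) \<in> E" "(f (Suc i), f i) \<in> E" if "i < n" for i
    using f(3)[OF that] sym by (auto dest: symD)
  define W where "W = insert c (f ` {..n})"
  have initial: "conn E (insert c (f ` {..<i}))" if "i \<le> Suc n" for i
    using that
  proof (induction i)
    case (Suc i)
    let ?a = "if i = 0 then c else f (i - 1)"
    have "(?a, f i) \<in> E" using p f(1) edge(1)[of "i - 1"] Suc.prems by auto
    moreover have "?a \<in> insert c (f ` {..<i})" by auto
    ultimately have "conn E (insert c (f ` {..<i}) \<union> {f i})"
      using Suc by (intro conn_Un[OF sym _ conn_singleton, of _ ?a]) auto
    then show ?case by (simp add: lessThan_Suc insert_commute)
  qed (simp add: conn_singleton)
  have final: "conn E (insert c (f ` {n - i<..n}))" if "i \<le> n" for i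
    using that
  proof (induction i)
    case (Suc i)
    let ?a = "if i = 0 then c else f (Suc (n - i))"
    have "(?a, f (n - i)) \<in> E" using q f(2) edge(2)[of "n - i"] Suc.prems by auto
    moreover have "?a \<in> insert c (f ` {n - i<..n})" using Suc.prems by auto
    ultimately have "conn E (insert c (f ` {n - i<..n}) \<union> {f (n - i)})"
      using Suc by (intro conn_Un[OF sym _ conn_singleton, of _ ?a]) auto
    moreover have "{n - Suc i<..n} = insert (n - i) {n - i<..n}" using Suc.prems by auto
    ultimately show ?case by (simp add: insert_commute)
  qed (simp add: conn_singleton)
  have middle: "conn E (f ` {..i})" if "i \<le> n" for i
    using that
  proof (induction i)
    case (Suc i)
    then have "conn E (f ` {..i} \<union> {f (Suc i)})"
      using edge(1)[of i] by (intro conn_Un[OF sym _ conn_singleton, of _ "f i"]) auto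
    then show ?case by (simp add: atMost_Suc)
  qed (simp add: conn_singleton)
  show ?thesis
  proof (rule that[of W])
    show "W \<subseteq> V" using fV cV by (auto simp: W_def)
    show "p \<in> W" "q \<in> W" using f by (auto simp: W_def)
    show "conn E W" using initial[of "Suc n"] by (simp add: W_def lessThan_Suc_atMost)
    fix w assume "w \<in> W"
    then consider "w = c" | i where "i \<le> n" "w = f i" by (auto simp: W_def)
    then show "conn E (W - {w})"
    proof cases
      case 1
      then have "W - {w} = f ` {..n}" using fV by (auto simp: W_def)
      then show ?thesis using middle[of n] by simp
    next
      case (2 i)
      \<comment> \<open>Removing \<open>f i\<close> from the cycle leaves two arcs that share
        \<open>c\<close>.\<close>
      have "W - {w} = insert c (f ` {..<i}) \<union> insert c (f ` {i<..n})"
      proof (intro equalityI subsetI)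
        fix z assume z: "z \<in> W - {w}"
        then consider "z = c" | j where "j \<le> n" "z = f j" by (auto simp: W_def)
        then show "z \<in> insert c (f ` {..<i}) \<union> insert c (f ` {i<..n})"
        proof cases
          case j: (2 j)
          then have "j \<noteq> i" using z 2 by auto
          then have "j < i \<or> i < j" by linarith
          then show ?thesis using j by auto
        qed simp
      next
        fix z assume "z \<in> insert c (f ` {..<i}) \<union> insert c (f ` {i<..n})"
        then consider "z = c" | j where "j < i" "z = f j" | j where "i < j" "j \<le> n" "z = f j"
          by auto
        then show "z \<in> W - {w}"
        proof cases
          case 1
          then show ?thesis using 2 fV[of i] by (auto simp: W_def)
        next
          case j: (2 j)
          then show ?thesis using 2 inj[of j i] by (auto simp: W_def)
        next
          case j: (3 j)
          then have "f j \<noteq> f i" using inj[of i j] by metis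
          then show ?thesis using 2 j by (auto simp: W_def)
        qed
      qed
      moreover have "conn E (insert c (f ` {i<..n}))" using final[of "n - i"] 2 by simp
      ultimately show ?thesis
        using initial[of i] 2 by (simp only:) (rule conn_Un[OF sym, of _ _ c c], auto)
    qed
  qed
qed

section \<open>Independence, blocks and diameter in terms of the relation\<close>

text \<open>The subgraph induced by a connected set extends to a component, and the vertex set of a
  component is itself connected.\<close>

lemma (in graph) Ind_eq_indep_sets: "Ind r G = indep_sets (verts G) (arcs_ends G) r"
proof -
  let ?P = "\<lambda>H. symmetric H \<and> Digraph_Component.connected H"
  have "r_independent r G A \<longleftrightarrow> (\<forall>T\<subseteq>A. conn (arcs_ends G) T \<longrightarrow> card T \<le> r)"
    if A: "A \<subseteq> verts G" for A
  proof -
    interpret GA: fin_digraph "G \<restriction> A"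
      using A subgraph_induce_subgraphI fin_digraph_subgraph by blast
    have finA: "finite A" using GA.finite_verts by simp
    show ?thesis
    proof
      assume ind: "r_independent r G A"
      show "\<forall>T\<subseteq>A. conn (arcs_ends G) T \<longrightarrow> card T \<le> r"
      proof (intro allI impI)
        fix T assume T: "T \<subseteq> A" "conn (arcs_ends G) T"
        have "subgraph (G \<restriction> T) (G \<restriction> A)"
          using T(1) by (auto simp: subgraph_def compatible_def GA.wf_digraph)
        moreover have "?P (G \<restriction> T)"
          using T(2) connected_induce_subgraph[OF sym_arcs] symmetric_induce_subgraph[OF sym_arcs]
          by blast
        ultimately obtain D where D: "GA.max_subgraph ?P D" "subgraph (G \<restriction> T) D"
          using GA.ex_max_subgraph[of "G \<restriction> T" ?P] by blast
        have "verts D \<subseteq> A" "T \<subseteq> verts D"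
          using D by (auto simp: GA.max_subgraph_def subgraph_def)
        then have "card T \<le> card (verts D)" using finA by (meson card_mono finite_subset)
        also have "\<dots> \<le> r" using D(1) ind by (simp add: r_independent_def component_def)
        finally show "card T \<le> r" .
      qed
    next
      assume card: "\<forall>T\<subseteq>A. conn (arcs_ends G) T \<longrightarrow> card T \<le> r"
      show "r_independent r G A"
        unfolding r_independent_def
      proof (intro conjI allI impI)
        fix C assume "component (G \<restriction> A) C"
        then have C: "subgraph C (G \<restriction> A)" "?P C"
          by (auto simp: component_def GA.max_subgraph_def)
        have "arcs_ends C \<subseteq> arcs_ends G"
          using arcs_ends_mono[OF C(1)] by (auto simp: arcs_ends_induce_subgraph)
        then have "conn (arcs_ends G) (verts C)"
          using C(2) connected_iff_conn[of C] by (auto intro: conn_mono)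
        moreover have "verts C \<subseteq> A" using C(1) by (auto simp: subgraph_def)
        ultimately show "card (verts C) \<le> r" using card by blast
      qed (rule A)
    qed
  qed
  moreover have "A \<subseteq> verts G" if "r_independent r G A" for A
    using that by (simp add: r_independent_def)
  ultimately show ?thesis by (auto simp: Ind_def indep_sets_def)
qed

text \<open>The cycle through \<open>c\<close>, \<open>p\<close> and \<open>q\<close> induces a
  subgraph without cut vertices. A maximal such subgraph above it is a block, hence complete, so
  \<open>p\<close> and \<open>q\<close> are adjacent.\<close>

lemma block_rel_if_block_graph:
  assumes "block_graph G"
  shows "block_rel (verts G) (arcs_ends G)"
proof -
  interpret graph G using assms by (simp add: block_graph_def)
  have sym: "sym (arcs_ends G)" using sym_arcs by (simp add: symmetric_def)
  show ?thesis
  proof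
    show "finite (verts G)" by simp
    show "arcs_ends G \<subseteq> verts G \<times> verts G" by (auto simp: arcs_ends_conv)
    show "sym (arcs_ends G)" by (rule sym)
    show "(a, a) \<notin> arcs_ends G" for a using no_loops by (auto simp: arcs_ends_conv)
    fix c p q
    assume c: "(c, p) \<in> arcs_ends G" "(c, q) \<in> arcs_ends G"
      and path: "(p, q) \<in> (Restr (arcs_ends G) (verts G - {c}))\<^sup>*"
    show "p = q \<or> (p, q) \<in> arcs_ends G"
    proof (cases "p = q")
      case ne: False
      have "c \<in> verts G" using c by (auto simp: arcs_ends_conv)
      then obtain W where W: "W \<subseteq> verts G" "p \<in> W" "q \<in> W" "conn (arcs_ends G) W"
        "\<And>w. w \<in> W \<Longrightarrow> conn (arcs_ends G) (W - {w})"
        using ex_cycle_set[OF sym c ne path] by blast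
      let ?P = "\<lambda>H. symmetric H \<and> Digraph_Component.connected H \<and>
            (\<forall>v\<in>verts H. verts H \<noteq> {v} \<longrightarrow> Digraph_Component.connected (pre_digraph.del_vert H v))"
      have "?P (G \<restriction> W)"
        using W(4,5) by (simp add: del_vert_induce_subgraph symmetric_induce_subgraph[OF sym_arcs]
            connected_induce_subgraph[OF sym_arcs])
      moreover have "subgraph (G \<restriction> W) G" by (rule subgraph_induce_subgraphI[OF W(1)])
      ultimately obtain B where B: "max_subgraph ?P B" "subgraph (G \<restriction> W) B"
        using ex_max_subgraph[of "G \<restriction> W" ?P] by blast
      then have "block G B" by (simp add: block_def)
      then obtain n where "K\<^bsub>n\<^esub> B" using assms by (auto simp: block_graph_def)
      moreover have "p \<in> verts B" "q \<in> verts B"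
        using B(2) W(2,3) by (auto simp: subgraph_def)
      ultimately have "(p, q) \<in> arcs_ends B" using ne by (auto simp: complete_digraph_def)
      moreover have "subgraph B G" using B(1) by (simp add: max_subgraph_def)
      ultimately show ?thesis using arcs_ends_mono by blast
    qed simp
  qed
qed

lemma (in wf_digraph) awalk_imp_relpow: "awalk u p v \<Longrightarrow> (u, v) \<in> arcs_ends G ^^ length p"
proof (induction p arbitrary: u)
  case Nil
  then show ?case by (simp add: awalk_Nil_iff)
next
  case (Cons e p)
  then have e: "e \<in> arcs G" "u = tail G e" "awalk (head G e) p v" by (auto simp: awalk_Cons_iff)
  then have "(u, head G e) \<in> arcs_ends G" by (auto simp: arcs_ends_conv)
  from relpow_Suc_I2[OF this Cons.IH[OF e(3)]] show ?case by simp
qed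

lemma (in wf_digraph) walk_if_diam_le:
  assumes "diam G \<le> ereal (real k)" "u \<in> verts G" "v \<in> verts G"
  shows "\<exists>n\<le>k. (u, v) \<in> arcs_ends G ^^ n"
proof -
  have "\<mu> (\<lambda>_. 1) u v \<le> diam G"
    unfolding diam_def using assms(2,3) by (meson SUP_upper SUP_upper2)
  also note assms(1)
  \<comment> \<open>A strict bound on the infimum yields an actual walk; its length is an integer
    below \<open>k + 1\<close>, hence at most \<open>k\<close>.\<close>
  also have "ereal (real k) < ereal (real k + 1)" by simp
  finally have "(INF p\<in>{p. awalk u p v}. ereal (awalk_cost (\<lambda>_. 1) p)) < ereal (real k + 1)"
    by (simp add: \<mu>_def)
  then obtain p where p: "awalk u p v" "ereal (awalk_cost (\<lambda>_. 1) p) < ereal (real k + 1)"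
    by (auto simp: INF_less_iff)
  have "awalk_cost (\<lambda>_. 1) p = length p" by (simp add: awalk_cost_def sum_list_triv)
  then have "length p \<le> k" using p(2) by simp
  then show ?thesis using awalk_imp_relpow[OF p(1)] by blast
qed

theorem theorem4p8:
  fixes G :: "('a, 'b) pre_digraph" and r :: nat
  assumes "block_graph G"
    and "diam G \<le> 4"
    and "r \<ge> 2"
  shows "shellable (Ind r G)"
proof -
  interpret graph G using assms(1) by (simp add: block_graph_def)
  interpret B: block_rel "verts G" "arcs_ends G"
    by (rule block_rel_if_block_graph[OF assms(1)])
  have "\<exists>x. link_simplicial (Ind r G) S x" if S: "S \<in> Ind r G" "S \<notin> facets (Ind r G)" for S
  proof -
    \<comment> \<open>A face strictly above \<open>S\<close> shows that the graph has a vertex, as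
      needed for a centre; for the graph without vertices there is no such \<open>S\<close>.\<close>
    obtain F where "F \<in> Ind r G" "S \<subset> F" using S by (auto simp: facets_def)
    then have ne: "verts G \<noteq> {}" by (auto simp: Ind_def r_independent_def)
    have "diam G \<le> ereal (real 4)" using assms(2) by simp
    from B.ex_center[OF ne walk_if_diam_le[OF this]]
    obtain v where "v \<in> verts G" "\<And>u. u \<in> verts G \<Longrightarrow> u = v \<or> (v, u) \<in> arcs_ends G \<or>
        (\<exists>w. (v, w) \<in> arcs_ends G \<and> (w, u) \<in> arcs_ends G)" by blast
    then interpret R: radius2_block_rel "verts G" "arcs_ends G" v
      by unfold_locales
    show ?thesis
      using R.ex_link_simplicial[of r S] S assms(3) by (simp add: Ind_eq_indep_sets)
  qed
  with simplicial_complex_Ind show ?thesis by (rule shellable_if_link_simplicial)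
qed

end
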